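(* Let $k$ be an algebraically closed field of characteristic zero and $R = k[x_1,x_2,x_3,x_4]$ with the standard grading. Let $A = R/I = R/\langle F_1,F_2,F_3,F_4 \rangle$, where $I$ is a complete intersection (the forms $F_1,\dots,F_4$ are a homogeneous regular sequence) and $\deg F_i = d_i$. Write $d_1+d_2+d_3+d_4 = 3\lambda + r$ with integers $\lambda, r$ and $0 \le r \le 2$. Let $L$ be a general linear form. Then the multiplication maps $\times L : [A]_{t-1} \rightarrow [A]_t$ are injective for all $t < \lambda$.
   Context: $[A]_t$ denotes the degree-$t$ homogeneous component of $A$. "For a general linear form $L$" means: for all $L$ in some nonempty Zariski-open subset of $[R]_1$. *)

theory Defs
  imports
    "HOL-Library.Poly_Mapping"
    "HOL-Library.Numeral_Type"
    "HOL-Computational_Algebra.Polynomial"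
    "HOL-Algebra.QuotRing"
    "HOL-Algebra.Algebraic_Closure_Type"
begin

text \<open>
  The polynomial ring in four variables: finitely supported functions from exponent vectors
  to coefficients, with the convolution product of \<^theory>\<open>HOL-Library.Poly_Mapping\<close>.
  The variables are indexed by the four-element type \<open>4\<close>.
\<close>

type_synonym 'k poly4 = "(4 \<Rightarrow>\<^sub>0 nat) \<Rightarrow>\<^sub>0 'k"

abbreviation poly4_ring :: "'k::comm_ring_1 poly4 ring" where
  "poly4_ring \<equiv> ring_of_type_algebra"

definition monom_deg :: "(4 \<Rightarrow>\<^sub>0 nat) \<Rightarrow> nat" where
  "monom_deg m = (\<Sum>i\<in>UNIV. Poly_Mapping.lookup m i)"

text \<open>Degrees range over the integers; components of negative degree are zero.\<close>

definition poly4_component :: "int \<Rightarrow> 'k::comm_ring_1 poly4 set" where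
  "poly4_component t = {f. \<forall>m\<in>Poly_Mapping.keys f. int (monom_deg m) = t}"

definition quot_component :: "'k::comm_ring_1 poly4 set \<Rightarrow> int \<Rightarrow> 'k poly4 set set" where
  "quot_component I t = (\<lambda>f. I +>\<^bsub>poly4_ring\<^esub> f) ` poly4_component t"

definition mult_map :: "'k::comm_ring_1 poly4 set \<Rightarrow> 'k poly4 \<Rightarrow> 'k poly4 set \<Rightarrow> 'k poly4 set" where
  "mult_map I L x = (I +>\<^bsub>poly4_ring\<^esub> L) \<otimes>\<^bsub>poly4_ring Quot I\<^esub> x"

definition nonzerodivisor_mod :: "('a, 'b) ring_scheme \<Rightarrow> 'a set \<Rightarrow> 'a \<Rightarrow> bool" where
  "nonzerodivisor_mod R J f \<longleftrightarrow>
     (\<forall>x\<in>carrier (R Quot J).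
        (J +>\<^bsub>R\<^esub> f) \<otimes>\<^bsub>R Quot J\<^esub> x = \<zero>\<^bsub>R Quot J\<^esub> \<longrightarrow> x = \<zero>\<^bsub>R Quot J\<^esub>)"

text \<open>
  As usual, the quotient by the whole sequence is required to be nonzero.  For forms over a
  field this forces all of them to be nonzero of positive degree.
\<close>

definition regular_sequence :: "('a, 'b) ring_scheme \<Rightarrow> 'a list \<Rightarrow> bool" where
  "regular_sequence R fs \<longleftrightarrow>
     set fs \<subseteq> carrier R \<and>
     (\<forall>i<length fs. nonzerodivisor_mod R (Idl\<^bsub>R\<^esub> (set (take i fs))) (fs ! i)) \<and>
     Idl\<^bsub>R\<^esub> (set fs) \<noteq> carrier R"

definition poly4_eval :: "'k::comm_ring_1 poly4 \<Rightarrow> (4 \<Rightarrow> 'k) \<Rightarrow> 'k" where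
  "poly4_eval p a =
     (\<Sum>m\<in>Poly_Mapping.keys p.
        Poly_Mapping.lookup p m * (\<Prod>i\<in>UNIV. a i ^ Poly_Mapping.lookup m i))"

definition linear_coeffs :: "'k::comm_ring_1 poly4 \<Rightarrow> 4 \<Rightarrow> 'k" where
  "linear_coeffs L i = Poly_Mapping.lookup L (Poly_Mapping.single i 1)"

text \<open>
  The linear forms are identified with affine 4-space through their coefficients; a Zariski-open
  set is the complement of the common zero set of a family \<open>S\<close> of polynomials.
\<close>

definition zariski_open_linear :: "'k::field poly4 set \<Rightarrow> bool" where
  "zariski_open_linear U \<longleftrightarrow>
     (\<exists>S :: 'k poly4 set.
        U = {L \<in> poly4_component 1. \<exists>p\<in>S. poly4_eval p (linear_coeffs L) \<noteq> 0})"

definition for_general_linear_form :: "('k::field poly4 \<Rightarrow> bool) \<Rightarrow> bool" where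
  "for_general_linear_form P \<longleftrightarrow>
     (\<exists>U. zariski_open_linear U \<and> U \<noteq> {} \<and> (\<forall>L\<in>U. P L))"

end

theory Submission
  imports Defs "Berlekamp_Zassenhaus.Unique_Factorization_Poly" "Jordan_Normal_Form.Determinant"
begin

text \<open>
  Suppose that the general linear form \<open>l\<close> kills a nonzero element of \<open>A\<close> of minimal degree
  \<open>e < \<lambda> - 1\<close>.  Since \<open>l\<close> is general, kernels of powers of \<open>l\<close> deform to first order, and this
  yields a nonzero socle element \<open>u\<close> of \<open>A/lA\<close> of degree at most \<open>e\<close> (the socle lemma of Huneke
  and Ulrich).  Write \<open>m\<^sub>a u = l b\<^sub>a + \<Sum>\<^sub>j k\<^sub>a\<^sub>j F\<^sub>j\<close> for linear forms \<open>m\<^sub>1, m\<^sub>2, m\<^sub>3\<close> that form a basis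
  modulo \<open>l\<close>.  The vectors \<open>m\<^sub>a k\<^sub>b - m\<^sub>b k\<^sub>a\<close> are syzygies of the \<open>F\<^sub>j\<close> modulo \<open>l\<close>.  By exactness
  of the Koszul complex, the \<open>2 \<times> 2\<close> minors of two such syzygies are combinations of the \<open>F\<^sub>j\<close> with
  coefficients of degree \<open>2(e + 2) - d\<^sub>i - d\<^sub>j - d\<^sub>k\<close>, and this is negative as long as all
  \<open>d\<^sub>j \<le> e + 1\<close>.  So all these syzygies are proportional, and because \<open>R/l\<close> is factorial, this forces
  \<open>u \<in> (F\<^sub>1, \<dots>, F\<^sub>4)\<close> modulo \<open>l\<close>, a contradiction.  If some \<open>d\<^sub>i > e + 1\<close>, then in degrees up to
  \<open>e + 1\<close> the ring \<open>A\<close> agrees with the quotient of \<open>R\<close> by the other three forms, which has no socle,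
  so that a general linear form is a nonzerodivisor there.
\<close>

section \<open>Koszul complexes of regular sequences\<close>

text \<open>How \<lambda> enters: for \<open>e + 2 \<le> \<lambda>\<close> and all degrees at most
  \<open>e + 1\<close>, any three of the four degrees sum to at least 3(e + 2) - (e + 1) = 2e + 5,
  just above the total degree 2(e + 2) of the minors. Generality is encoded as maximal rank:
  multiplication by each power of l has, in finitely many degrees, the largest rank that any linear
  form attains. Rank can only jump up on an open set, so such forms exist, and an increase of rank
  along the pencil l + s m is a contradiction; this is what makes kernels deform. The derivative of
  a power brings in a factor k + 1, which has to be invertible. Four forms of positive degree are
  never a regular sequence in the three variables of R/l. The Koszul argument is therefore run in R,
  with multiples of l carried along as error terms; only the factorization of the proportional
  syzygies takes place in R/l. When one degree is large, the argument yields just one good linear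
  form. Injectivity in a fixed degree is again a rank condition, so every form of maximal rank
  inherits it.\<close>

definition regular_upto :: "nat \<Rightarrow> (nat \<Rightarrow> 'a::comm_ring_1) \<Rightarrow> bool" where
  "regular_upto n F \<longleftrightarrow>
     (\<forall>m<n. \<forall>x c. x * F m = (\<Sum>j<m. c j * F j) \<longrightarrow> (\<exists>c'. x = (\<Sum>j<m. c' j * F j)))"

text \<open>The first Koszul homology vanishes. Regularity at the last form expresses
  \<open>G n\<close> through the earlier forms, and substituting this leaves a relation among the
  first \<open>n\<close> forms. \<open>W i i = 0\<close> is listed separately because antisymmetry
  does not give it when 2 is a zero divisor.\<close>

lemma koszul_exact_1:
  fixes F G :: "nat \<Rightarrow> 'a::comm_ring_1"
  assumes "regular_upto n F" and "(\<Sum>i<n. G i * F i) = 0"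
  shows "\<exists>W. (\<forall>i j. W j i = - W i j) \<and> (\<forall>i. W i i = 0) \<and> (\<forall>i<n. G i = (\<Sum>j<n. W i j * F j))"
  using assms
proof (induction n arbitrary: G)
  case 0
  show ?case by (rule exI[of _ "\<lambda>_ _. 0"]) simp
next
  case (Suc n)
  have "G n * F n = (\<Sum>j<n. (- G j) * F j)"
    using Suc.prems(2) by (simp add: sum_negf eq_neg_iff_add_eq_0 add.commute)
  then obtain c where c: "G n = (\<Sum>j<n. c j * F j)"
    using Suc.prems(1) unfolding regular_upto_def by (meson lessI)
  have "regular_upto n F" using Suc.prems(1) unfolding regular_upto_def by auto
  moreover have "(\<Sum>i<n. (G i + c i * F n) * F i) = 0"
  proof -
    have "(\<Sum>i<n. (G i + c i * F n) * F i) = (\<Sum>i<n. G i * F i) + F n * (\<Sum>i<n. c i * F i)"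
      by (simp add: algebra_simps sum.distrib sum_distrib_left)
    also have "\<dots> = (\<Sum>i<Suc n. G i * F i)" using c by (simp add: mult.commute)
    finally show ?thesis using Suc.prems(2) by simp
  qed
  ultimately obtain W where W: "\<And>i j. W j i = - W i j" "\<And>i. W i i = 0"
      "\<And>i. i < n \<Longrightarrow> G i + c i * F n = (\<Sum>j<n. W i j * F j)"
    using Suc.IH[of "\<lambda>i. G i + c i * F n"] by blast
  define V where "V i j = (if i = n then if j = n then 0 else c j else if j = n then - c i else W i j)" for i j
  have "V j i = - V i j" for i j using W(1)[of i j] by (auto simp: V_def)
  moreover have "V i i = 0" for i using W(2) by (simp add: V_def)
  moreover have "G i = (\<Sum>j<Suc n. V i j * F j)" if "i < Suc n" for i
  proof (cases "i = n")
    case True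
    then show ?thesis using c by (simp add: V_def)
  next
    case False
    with that have "i < n" by simp
    then show ?thesis using W(3)[of i] by (simp add: V_def algebra_simps)
  qed
  ultimately show ?case by blast
qed

text \<open>The second Koszul homology vanishes, again by splitting off the last form: the last row
  of \<open>W\<close> is itself a relation, hence given by an alternating \<open>T\<close>, and
  subtracting \<open>T i j * F n\<close> leaves a cycle on the first \<open>n\<close> forms. The
  vanishing of \<open>E\<close> at repeated indices is recorded for the degree count in
  \<open>minors_dvd\<close>.\<close>

lemma koszul_exact_2:
  fixes F :: "nat \<Rightarrow> 'a::comm_ring_1"
  assumes "regular_upto n F" and "\<And>i j. W j i = - W i j" and "\<And>i. W i i = 0"
    and "\<And>i. i < n \<Longrightarrow> (\<Sum>j<n. W i j * F j) = 0"
  shows "\<exists>E. \<forall>i<n. \<forall>j<n. W i j = (\<Sum>k<n. E i j k * F k) \<and> E i j i = 0 \<and> E i j j = 0"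
  using assms
proof (induction n arbitrary: W)
  case 0
  show ?case by simp
next
  case (Suc n)
  have reg: "regular_upto n F" using Suc.prems(1) unfolding regular_upto_def by auto
  have "(\<Sum>j<n. W n j * F j) = 0" using Suc.prems(4)[of n] Suc.prems(3)[of n] by simp
  from koszul_exact_1[OF reg this] obtain T where T: "\<And>i j. T j i = - T i j" "\<And>i. T i i = 0"
      "\<And>i. i < n \<Longrightarrow> W n i = (\<Sum>j<n. T i j * F j)" by blast
  define W' where "W' i j = W i j - T i j * F n" for i j
  have "(\<Sum>j<n. W' i j * F j) = 0" if "i < n" for i
  proof -
    have "(\<Sum>j<n. W' i j * F j) = (\<Sum>j<n. W i j * F j) - F n * (\<Sum>j<n. T i j * F j)"
      by (simp add: W'_def algebra_simps sum_subtractf sum_distrib_left)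
    also have "\<dots> = (\<Sum>j<Suc n. W i j * F j)"
      using Suc.prems(2)[of n i] unfolding T(3)[OF that, symmetric] by (simp add: mult.commute)
    finally show ?thesis using Suc.prems(4)[of i] that by simp
  qed
  moreover have "W' j i = - W' i j" for i j
    using Suc.prems(2)[of i j] T(1)[of i j] by (simp add: W'_def algebra_simps)
  moreover have "W' i i = 0" for i using Suc.prems(3) T(2) by (simp add: W'_def)
  ultimately obtain E where E: "\<And>i j. i < n \<Longrightarrow> j < n \<Longrightarrow> W' i j = (\<Sum>k<n. E i j k * F k)"
      "\<And>i j. i < n \<Longrightarrow> j < n \<Longrightarrow> E i j i = 0 \<and> E i j j = 0"
    using Suc.IH[OF reg, of W'] by blast
  \<comment> \<open>\<open>T\<close> fills the entries with exactly one index equal to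
    \<open>n\<close>; the sign follows the position of that index.\<close>
  define H where "H i j k =
    (if i = n then if j = n \<or> k = n then 0 else T j k
     else if j = n then if k = n then 0 else - T i k
     else if k = n then T i j else E i j k)" for i j k
  have "W i j = (\<Sum>k<Suc n. H i j k * F k) \<and> H i j i = 0 \<and> H i j j = 0" if ij: "i < Suc n" "j < Suc n" for i j
  proof -
    consider "i = n" "j = n" | "i = n" "j < n" | "i < n" "j = n" | "i < n" "j < n"
      using ij by linarith
    then show ?thesis
    proof cases
      case 1
      then show ?thesis using Suc.prems(3) by (simp add: H_def)
    next
      case 2
      then show ?thesis using T(2,3) by (simp add: H_def)
    next
      case 3
      then show ?thesis using T(2,3) Suc.prems(2)[of n i] by (simp add: H_def sum_negf)
    next
      case 4
      then show ?thesis using E[of i j] by (simp add: H_def W'_def algebra_simps)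
    qed
  qed
  then show ?case by blast
qed

section \<open>Rank one matrices over factorial domains\<close>

lemma ufd_gcd_finite:
  fixes f :: "'i \<Rightarrow> 'a::ufd"
  assumes "finite B"
  shows "\<exists>d. (\<forall>j\<in>B. d dvd f j) \<and> (\<forall>e. (\<forall>j\<in>B. e dvd f j) \<longrightarrow> e dvd d)"
  using assms
proof (induction B)
  case empty
  show ?case by (rule exI[of _ 0]) simp
next
  case (insert b B)
  interpret some_gcd: idom_gcd "(*)" "1 :: 'a" "(+)" 0 "(-)" uminus some_gcd
    rewrites "dvd.dvd ((*)) = (dvd)" by (unfold_locales, auto simp: dvd_rewrites)
  from insert.IH obtain d where d: "\<And>j. j \<in> B \<Longrightarrow> d dvd f j"
    "\<And>e. (\<And>j. j \<in> B \<Longrightarrow> e dvd f j) \<Longrightarrow> e dvd d" by blast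
  show ?case
    by (rule exI[of _ "some_gcd (f b) d"])
      (auto intro: d dvd_trans[OF some_gcd.gcd_dvd2] some_gcd.gcd_greatest)
qed

text \<open>Gcds commute with multiplication by \<open>h\<close>: the gcd of all
  \<open>g j * h\<close> has the form \<open>D' * h\<close>, where \<open>D'\<close> divides every
  \<open>g j\<close> and so is a unit.\<close>

lemma ufd_dvd_of_coprime_family:
  fixes g :: "'i \<Rightarrow> 'a::ufd"
  assumes fin: "finite B" and cop: "\<And>e. (\<And>j. j \<in> B \<Longrightarrow> e dvd g j) \<Longrightarrow> e dvd 1"
    and dvd: "\<And>j. j \<in> B \<Longrightarrow> x dvd g j * h"
  shows "x dvd h"
proof (cases "h = 0")
  case False
  obtain D where D: "\<And>j. j \<in> B \<Longrightarrow> D dvd g j * h"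
      "\<And>e. (\<And>j. j \<in> B \<Longrightarrow> e dvd g j * h) \<Longrightarrow> e dvd D"
    using ufd_gcd_finite[OF fin, of "\<lambda>j. g j * h"] by blast
  have "h dvd D" by (rule D(2)) simp
  then obtain D' where D': "D = D' * h" by (metis dvd_def mult.commute)
  have "D' dvd g j" if "j \<in> B" for j using D(1)[OF that] False by (simp add: D')
  then have "D' dvd 1" by (rule cop)
  then have "D dvd h" unfolding D' by (metis dvd_refl mult_1 mult_dvd_mono)
  moreover have "x dvd D" by (rule D(2)) (rule dvd)
  ultimately show ?thesis by (rule dvd_trans[rotated])
qed simp

text \<open>Over the fraction field the rows are proportional. Dividing the nonzero row
  \<open>a0\<close> by its content \<open>d\<close> gives a primitive row \<open>g\<close>, and as
  in Gauss's lemma every other row is a multiple of \<open>g\<close> without denominators.\<close>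

lemma rank_one_factorization:
  fixes h :: "'r \<Rightarrow> 'c \<Rightarrow> 'a::ufd"
  assumes fin: "finite B"
    and minors: "\<And>a b i j. a \<in> A \<Longrightarrow> b \<in> A \<Longrightarrow> i \<in> B \<Longrightarrow> j \<in> B \<Longrightarrow> h a i * h b j = h a j * h b i"
    and nz: "a0 \<in> A" "j0 \<in> B" "h a0 j0 \<noteq> 0"
  shows "\<exists>p g. p a0 \<noteq> 0 \<and> g j0 \<noteq> 0 \<and> (\<forall>a\<in>A. \<forall>j\<in>B. h a j = p a * g j)"
proof -
  obtain d where d: "\<And>j. j \<in> B \<Longrightarrow> d dvd h a0 j"
      "\<And>e. (\<And>j. j \<in> B \<Longrightarrow> e dvd h a0 j) \<Longrightarrow> e dvd d"
    using ufd_gcd_finite[OF fin, of "h a0"] by blast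
  then have "\<forall>j\<in>B. \<exists>g. h a0 j = d * g" by (auto simp: dvd_def)
  then obtain g where g: "\<And>j. j \<in> B \<Longrightarrow> h a0 j = d * g j" by metis
  have d0: "d \<noteq> 0" and g0: "g j0 \<noteq> 0" using nz g[of j0] by auto
  have cop: "e dvd 1" if e: "\<And>j. j \<in> B \<Longrightarrow> e dvd g j" for e
  proof -
    have "d * e dvd d" by (rule d(2)) (simp add: g e)
    then show ?thesis using d0 by (metis mult.right_neutral dvd_mult_cancel_left)
  qed
  have cross: "h a i * g j = h a j * g i" if "a \<in> A" "i \<in> B" "j \<in> B" for a i j
  proof -
    have "d * (h a i * g j) = d * (h a j * g i)"
      using minors[OF nz(1) that(1) that(3,2)] g that by (simp add: ac_simps)
    then show ?thesis using d0 by simp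
  qed
  have "\<exists>p. h a j0 = p * g j0" if "a \<in> A" for a
  proof -
    have "g j0 dvd h a j0"
    proof (rule ufd_dvd_of_coprime_family[OF fin cop])
      fix j assume "j \<in> B"
      then show "g j0 dvd g j * h a j0" using cross[OF that \<open>j \<in> B\<close> nz(2)]
        by (metis dvd_triv_right mult.commute)
    qed
    then show ?thesis by (metis dvd_def mult.commute)
  qed
  then obtain p where p: "\<And>a. a \<in> A \<Longrightarrow> h a j0 = p a * g j0" by metis
  have "h a j = p a * g j" if "a \<in> A" "j \<in> B" for a j
  proof -
    have "h a j * g j0 = (p a * g j) * g j0"
      using cross[OF that nz(2)] p[OF that(1)] by (simp add: ac_simps)
    then show ?thesis using g0 by simp
  qed
  moreover have "p a0 \<noteq> 0" using p[OF nz(1)] nz(3) by auto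
  ultimately show ?thesis using g0 by blast
qed

text \<open>\<open>h\<close> consists of the 2 by 2 minors of \<open>(x, y, z)\<close> against
  \<open>(k1, k2, k3)\<close>. If \<open>h a j = p a * g j\<close>, then \<open>p\<close> is a
  Koszul cycle for the regular sequence \<open>x, y, z\<close>, hence the vector of minors of
  \<open>(x, y, z)\<close> against some \<open>c\<close>. So \<open>(k1, k2, k3) - c * g\<close> is
  proportional to \<open>(x, y, z)\<close>, with a quotient \<open>w\<close>. Since the rows of
  \<open>h\<close>, and with them \<open>g\<close>, are syzygies of \<open>f\<close>, contracting
  with \<open>f\<close> leaves \<open>u\<close> as the combination with coefficients
  \<open>w\<close>.\<close>

lemma rank_one_socle:
  fixes x y z u :: "'a::ufd" and f k1 k2 k3 :: "nat \<Rightarrow> 'a" and h :: "nat \<Rightarrow> nat \<Rightarrow> 'a"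
  assumes x0: "x \<noteq> 0"
    and xy: "\<And>v w. y * v = x * w \<Longrightarrow> x dvd v"
    and xyz: "\<And>v a b. z * v = x * a + y * b \<Longrightarrow> \<exists>a' b'. v = x * a' + y * b'"
    and u: "x * u = (\<Sum>j<n. k1 j * f j)" "y * u = (\<Sum>j<n. k2 j * f j)" "z * u = (\<Sum>j<n. k3 j * f j)"
    and h: "\<And>j. h 0 j = x * k2 j - y * k1 j" "\<And>j. h 1 j = x * k3 j - z * k1 j"
           "\<And>j. h 2 j = y * k3 j - z * k2 j"
    and minors: "\<And>a b i j. a < 3 \<Longrightarrow> b < 3 \<Longrightarrow> i < n \<Longrightarrow> j < n \<Longrightarrow> h a i * h b j = h a j * h b i"
  shows "\<exists>w. u = (\<Sum>j<n. w j * f j)"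
proof -
  \<comment> \<open>A vector proportional to \<open>(x, y, z)\<close> is a multiple of it, because
    \<open>y\<close> is a nonzerodivisor modulo \<open>x\<close>.\<close>
  have div: "\<exists>w. v1 = x * w \<and> v2 = y * w \<and> v3 = z * w"
    if "x * v2 = y * v1" "x * v3 = z * v1" for v1 v2 v3
  proof -
    from that(1) have "x dvd v1" by (intro xy[of _ v2]) simp
    then obtain w where w: "v1 = x * w" by (auto simp: dvd_def)
    have "x * v2 = x * (y * w)" "x * v3 = x * (z * w)" using that w by (simp_all add: ac_simps)
    then show ?thesis using x0 w by auto
  qed
  have "\<exists>c g. (\<Sum>j<n. g j * f j) = 0 \<and> (\<forall>j<n. x * (k2 j - c 1 * g j) = y * (k1 j - c 0 * g j) \<and>
          x * (k3 j - c 2 * g j) = z * (k1 j - c (0::nat) * g j))"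
  proof (cases "\<exists>a<3. \<exists>j<n. h a j \<noteq> 0")
    case False
    then have "h 0 j = 0" "h 1 j = 0" if "j < n" for j
      using that by auto
    then show ?thesis unfolding h
      by (intro exI[of _ "\<lambda>_. 0"]) simp
  next
    case True
    then obtain a0 j0 where nz: "a0 < 3" "j0 < n" "h a0 j0 \<noteq> 0" by blast
    obtain p g where p0: "p a0 \<noteq> 0" and g0: "g j0 \<noteq> 0"
      and pg: "\<And>a j. a < 3 \<Longrightarrow> j < n \<Longrightarrow> h a j = p a * g j"
      using rank_one_factorization[of "{..<n}" "{..<3}" h a0 j0] minors nz by (auto 4 4)
    have syz: "(\<Sum>j<n. h a j * f j) = 0" if "a < 3" for a
    proof -
      have "(\<Sum>j<n. h 0 j * f j) = x * (\<Sum>j<n. k2 j * f j) - y * (\<Sum>j<n. k1 j * f j)"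
           "(\<Sum>j<n. h 1 j * f j) = x * (\<Sum>j<n. k3 j * f j) - z * (\<Sum>j<n. k1 j * f j)"
           "(\<Sum>j<n. h 2 j * f j) = y * (\<Sum>j<n. k3 j * f j) - z * (\<Sum>j<n. k2 j * f j)"
        by (simp_all add: h left_diff_distrib sum_subtractf sum_distrib_left mult.assoc del: One_nat_def)
      then have "(\<Sum>j<n. h 0 j * f j) = 0" "(\<Sum>j<n. h 1 j * f j) = 0" "(\<Sum>j<n. h 2 j * f j) = 0"
        unfolding u[symmetric] by (simp_all add: ac_simps del: One_nat_def)
      moreover have "a = 0 \<or> a = 1 \<or> a = 2" using that by auto
      ultimately show ?thesis by auto
    qed
    have "p a0 * (\<Sum>j<n. g j * f j) = (\<Sum>j<n. h a0 j * f j)"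
      unfolding sum_distrib_left by (rule sum.cong) (use pg nz in \<open>auto simp: mult.assoc\<close>)
    then have g: "(\<Sum>j<n. g j * f j) = 0" using syz[OF nz(1)] p0 by simp
    \<comment> \<open>The Koszul identity between the three minors; it passes to \<open>p\<close>
      because the entry \<open>g j0\<close> can be cancelled.\<close>
    have "z * h 0 j0 - y * h 1 j0 + x * h 2 j0 = 0"
      by (simp add: h algebra_simps del: One_nat_def)
    then have "(z * p 0 - y * p 1 + x * p 2) * g j0 = 0"
      using pg[OF _ nz(2)] by (simp add: algebra_simps del: One_nat_def)
    then have rel: "z * p 0 - y * p 1 + x * p 2 = 0" using g0 by simp
    then have "z * p 0 = x * (- p 2) + y * p 1" by (simp add: algebra_simps)
    then obtain al be where p0: "p 0 = x * al + y * be" using xyz by blast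
    have "y * (p 1 - z * be) = x * (p 2 + z * al)" using rel by (simp add: p0 algebra_simps)
    then obtain ga where "p 1 - z * be = x * ga" by (meson xy dvd_def)
    then have p1: "p 1 = x * ga + z * be" by (simp add: algebra_simps)
    \<comment> \<open>Chosen so that \<open>p 0 = x * c 1 - y * c 0\<close> and
      \<open>p 1 = x * c 2 - z * c 0\<close>.\<close>
    define c :: "nat \<Rightarrow> 'a" where "c i = (if i = 0 then - be else if i = 1 then al else ga)" for i
    have "x * (k2 j - c 1 * g j) = y * (k1 j - c 0 * g j)" "x * (k3 j - c 2 * g j) = z * (k1 j - c 0 * g j)"
      if "j < n" for j
      using pg[of 0 j] pg[of 1 j] that by (simp_all add: h p0 p1 c_def algebra_simps del: One_nat_def)
    then show ?thesis using g by blast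
  qed
  then obtain c g where g: "(\<Sum>j<n. g j * f j) = 0"
    and cg: "\<And>j. j < n \<Longrightarrow> x * (k2 j - c 1 * g j) = y * (k1 j - c 0 * g j) \<and>
          x * (k3 j - c 2 * g j) = z * (k1 j - c (0::nat) * g j)" by blast
  from div cg have "\<forall>j. \<exists>w. j < n \<longrightarrow> k1 j - c 0 * g j = x * w" by meson
  then obtain w where w: "\<And>j. j < n \<Longrightarrow> k1 j = c 0 * g j + x * w j"
    by (metis add.commute diff_eq_eq)
  have "x * u = (\<Sum>j<n. c 0 * (g j * f j) + x * (w j * f j))"
    unfolding u(1) by (rule sum.cong) (auto simp: w algebra_simps)
  also have "\<dots> = x * (\<Sum>j<n. w j * f j)"
    by (simp add: sum.distrib sum_distrib_left[symmetric] g)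
  finally show ?thesis using x0 by auto
qed

text \<open>Evaluation at 0 is reduction modulo the outermost variable, so divisibility by
  \<open>x\<close> means vanishing at 0, and the same works one level deeper for \<open>y\<close>.
  Nested univariate polynomials model k[x, y, z] because they are of class \<open>ufd\<close>, as
  \<open>rank_one_socle\<close> requires.\<close>

lemma poly3_coordinates:
  defines "x \<equiv> [:0, 1:] :: 'k::field poly poly poly" and "y \<equiv> [:[:0, 1:]:] :: 'k poly poly poly"
    and "z \<equiv> [:[:[:0, 1:]:]:] :: 'k poly poly poly"
  shows "x \<noteq> 0" and "\<And>v w. y * v = x * w \<Longrightarrow> x dvd v"
    and "\<And>v a b. z * v = x * a + y * b \<Longrightarrow> \<exists>a' b'. v = x * a' + y * b'"
proof -
  show "x \<noteq> 0" by (simp add: x_def)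
next
  fix v w assume "y * v = x * w"
  then have "poly (y * v) 0 = poly (x * w) 0" by simp
  then have "poly v 0 = 0" by (simp add: x_def y_def)
  then show "x dvd v" unfolding x_def by (metis dvd_iff_poly_eq_0 add.inverse_neutral)
next
  fix v a b assume "z * v = x * a + y * b"
  then have "poly (poly (z * v) 0) 0 = poly (poly (x * a + y * b) 0) 0" by simp
  then have "poly (poly v 0) 0 = 0" by (simp add: x_def y_def z_def)
  then have "[:0, 1:] dvd poly v 0" by (metis dvd_iff_poly_eq_0 add.inverse_neutral)
  then obtain q where q: "poly v 0 = [:0, 1:] * q" by (auto simp: dvd_def)
  have "poly (v - y * [:q:]) 0 = 0" by (simp add: q y_def)
  then have "x dvd v - y * [:q:]" unfolding x_def by (metis dvd_iff_poly_eq_0 add.inverse_neutral)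
  then obtain a' where "v - y * [:q:] = x * a'" by (auto simp: dvd_def)
  then show "\<exists>a' b'. v = x * a' + y * b'" by (metis diff_eq_eq)
qed

section \<open>The grading and evaluation homomorphisms\<close>

lemma monom_deg_add: "monom_deg (m + m') = monom_deg m + monom_deg m'"
  by (simp add: monom_deg_def lookup_add sum.distrib)

lemma monom_deg_single: "monom_deg (Poly_Mapping.single i n) = n"
  by (simp add: monom_deg_def lookup_single when_def)

lemma component_zero: "0 \<in> poly4_component t"
  by (simp add: poly4_component_def)

lemma component_add: "f \<in> poly4_component t \<Longrightarrow> g \<in> poly4_component t \<Longrightarrow> f + g \<in> poly4_component t"
  unfolding poly4_component_def using Poly_Mapping.keys_add by fastforce

lemma component_uminus: "f \<in> poly4_component t \<Longrightarrow> - f \<in> poly4_component t"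
  unfolding poly4_component_def by (simp add: in_keys_iff)

lemma component_diff: "f \<in> poly4_component t \<Longrightarrow> g \<in> poly4_component t \<Longrightarrow> f - g \<in> poly4_component t"
  using component_add[of f t "- g"] component_uminus[of g t] by simp

lemma component_sum: "(\<And>i. i \<in> A \<Longrightarrow> f i \<in> poly4_component t) \<Longrightarrow> sum f A \<in> poly4_component t"
  by (induction A rule: infinite_finite_induct) (auto intro: component_add component_zero)

lemma component_mult:
  assumes "f \<in> poly4_component s" "g \<in> poly4_component t"
  shows "f * g \<in> poly4_component (s + t)"
  using assms keys_mult[of f g] by (fastforce simp: poly4_component_def monom_deg_add)

lemma component_neg: "f \<in> poly4_component t \<Longrightarrow> t < 0 \<Longrightarrow> f = 0"
  by (force simp: poly4_component_def)

lemma component_const: "Poly_Mapping.single 0 c \<in> poly4_component 0"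
  by (auto simp: poly4_component_def monom_deg_def split: if_splits)

lemma component_scale: "f \<in> poly4_component t \<Longrightarrow> Poly_Mapping.single 0 c * f \<in> poly4_component t"
  using component_mult[OF component_const] by force

lemma component_power: "f \<in> poly4_component 1 \<Longrightarrow> f ^ n \<in> poly4_component (int n)"
proof (induction n)
  case 0
  show ?case using component_const[of 1] by (simp add: single_one)
next
  case (Suc n)
  then show ?case using component_mult[of f 1 "f ^ n" "int n"] by simp
qed

definition hcomp :: "int \<Rightarrow> 'k::comm_ring_1 poly4 \<Rightarrow> 'k poly4" where
  "hcomp t f = Poly_Mapping.mapp (\<lambda>m c. c when int (monom_deg m) = t) f"

lemma lookup_hcomp: "Poly_Mapping.lookup (hcomp t f) m = (Poly_Mapping.lookup f m when int (monom_deg m) = t)"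
  by (auto simp: hcomp_def mapp.rep_eq in_keys_iff when_def)

lemma hcomp_in: "hcomp t f \<in> poly4_component t"
  by (auto simp: poly4_component_def in_keys_iff lookup_hcomp)

lemma hcomp_id: "f \<in> poly4_component t \<Longrightarrow> hcomp t f = f"
  by (rule poly_mapping_eqI) (auto simp: lookup_hcomp poly4_component_def when_def in_keys_iff)

lemma hcomp_add: "hcomp t (f + g) = hcomp t f + hcomp t g"
  by (rule poly_mapping_eqI) (auto simp: lookup_hcomp lookup_add when_def)

lemma hcomp_zero: "hcomp t 0 = 0"
  by (rule poly_mapping_eqI) (auto simp: lookup_hcomp)

lemma hcomp_sum: "hcomp t (sum f A) = (\<Sum>i\<in>A. hcomp t (f i))"
  by (induction A rule: infinite_finite_induct) (auto simp: hcomp_add hcomp_zero)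

text \<open>The part of \<open>f\<close> outside degree \<open>t - s\<close> contributes nothing to
  degree \<open>t\<close> of the product. With additivity, this replaces the coefficients in an
  identity between forms by homogeneous ones of the expected degrees.\<close>

lemma hcomp_mult:
  assumes g: "g \<in> poly4_component s"
  shows "hcomp t (f * g) = hcomp (t - s) f * g"
proof -
  have "hcomp t ((f - hcomp (t - s) f) * g) = 0"
  proof (rule poly_mapping_eqI)
    fix m
    have "Poly_Mapping.lookup ((f - hcomp (t - s) f) * g) m = 0" if "int (monom_deg m) = t"
    proof (rule ccontr)
      assume "Poly_Mapping.lookup ((f - hcomp (t - s) f) * g) m \<noteq> 0"
      then obtain a b where ab: "m = a + b" "a \<in> Poly_Mapping.keys (f - hcomp (t - s) f)" "b \<in> Poly_Mapping.keys g"
        using keys_mult by (fastforce simp: in_keys_iff)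
      then have "int (monom_deg b) = s" using g by (auto simp: poly4_component_def)
      then have "int (monom_deg a) = t - s" using that by (simp add: ab(1) monom_deg_add)
      then show False using ab(2) by (simp add: in_keys_iff lookup_minus lookup_hcomp)
    qed
    then show "Poly_Mapping.lookup (hcomp t ((f - hcomp (t - s) f) * g)) m = Poly_Mapping.lookup 0 m"
      by (simp add: lookup_hcomp when_def)
  qed
  moreover have "hcomp t (hcomp (t - s) f * g) = hcomp (t - s) f * g"
    by (rule hcomp_id) (use component_mult[OF hcomp_in g, of "t - s" f] in simp)
  moreover have "f * g = (f - hcomp (t - s) f) * g + hcomp (t - s) f * g"
    by (simp add: algebra_simps)
  ultimately show ?thesis by (metis hcomp_add add_0)
qed

definition pvar :: "4 \<Rightarrow> 'k::comm_ring_1 poly4" where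
  "pvar i = Poly_Mapping.single (Poly_Mapping.single i 1) 1"

lemma pvar_component: "pvar i \<in> poly4_component 1"
  by (auto simp: pvar_def poly4_component_def monom_deg_single split: if_splits)

text \<open>The universal map out of the polynomial ring, given by \<open>\<phi>\<close> on
  coefficients and \<open>v\<close> on variables. It serves as point evaluation, as the quotient map
  modulo a linear form, and, at the variables themselves, as the identity.\<close>

definition pm_eval :: "('k \<Rightarrow> 'a) \<Rightarrow> (4 \<Rightarrow> 'a) \<Rightarrow> 'k::comm_ring_1 poly4 \<Rightarrow> 'a::comm_ring_1" where
  "pm_eval \<phi> v f = (\<Sum>m\<in>Poly_Mapping.keys f. \<phi> (Poly_Mapping.lookup f m) * (\<Prod>i\<in>UNIV. v i ^ Poly_Mapping.lookup m i))"

lemma poly_mapping_as_sum: "f = (\<Sum>m\<in>Poly_Mapping.keys f. Poly_Mapping.single m (Poly_Mapping.lookup f m))"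
proof (rule poly_mapping_eqI)
  fix k
  have "Poly_Mapping.lookup (\<Sum>m\<in>Poly_Mapping.keys f. Poly_Mapping.single m (Poly_Mapping.lookup f m)) k
      = (\<Sum>m\<in>Poly_Mapping.keys f. if m = k then Poly_Mapping.lookup f m else 0)"
    by (simp add: lookup_sum lookup_single when_def)
  also have "\<dots> = Poly_Mapping.lookup f k" by (simp add: in_keys_iff)
  finally show "Poly_Mapping.lookup f k = Poly_Mapping.lookup (\<Sum>m\<in>Poly_Mapping.keys f. Poly_Mapping.single m (Poly_Mapping.lookup f m)) k" by simp
qed

lemma pm_eval_hom:
  assumes "comm_ring_hom \<phi>"
  shows "comm_ring_hom (pm_eval \<phi> v)"
proof -
  interpret \<phi>: comm_ring_hom \<phi> by fact
  have add: "pm_eval \<phi> v (p + q) = pm_eval \<phi> v p + pm_eval \<phi> v q" for p q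
    unfolding pm_eval_def
    by (rule setsum_keys_plus_distrib) (auto simp: \<phi>.hom_add algebra_simps)
  have zero: "pm_eval \<phi> v 0 = 0" by (simp add: pm_eval_def)
  have sum: "pm_eval \<phi> v (sum g A) = (\<Sum>i\<in>A. pm_eval \<phi> v (g i))" for g :: "'c \<Rightarrow> _" and A
    by (induction A rule: infinite_finite_induct) (auto simp: add zero)
  have single: "pm_eval \<phi> v (Poly_Mapping.single m c) = \<phi> c * (\<Prod>i\<in>UNIV. v i ^ Poly_Mapping.lookup m i)" for m c
    by (simp add: pm_eval_def)
  have "pm_eval \<phi> v (p * q) = pm_eval \<phi> v p * pm_eval \<phi> v q" for p q
  proof -
    have "p * q = (\<Sum>m\<in>Poly_Mapping.keys p. \<Sum>m'\<in>Poly_Mapping.keys q. Poly_Mapping.single (m + m') (Poly_Mapping.lookup p m * Poly_Mapping.lookup q m'))"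
      by (subst poly_mapping_as_sum[of p], subst poly_mapping_as_sum[of q])
        (simp add: sum_product mult_single)
    then have "pm_eval \<phi> v (p * q) = (\<Sum>m\<in>Poly_Mapping.keys p. \<Sum>m'\<in>Poly_Mapping.keys q.
        (\<phi> (Poly_Mapping.lookup p m) * (\<Prod>i\<in>UNIV. v i ^ Poly_Mapping.lookup m i)) * (\<phi> (Poly_Mapping.lookup q m') * (\<Prod>i\<in>UNIV. v i ^ Poly_Mapping.lookup m' i)))"
      by (simp add: sum single \<phi>.hom_mult lookup_add power_add prod.distrib ac_simps)
    then show ?thesis unfolding pm_eval_def by (simp add: sum_product)
  qed
  moreover have "pm_eval \<phi> v 1 = 1"
    using single[of 0 1] by (simp add: single_one)
  ultimately show ?thesis by unfold_locales (auto simp: add zero)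
qed

lemma pm_eval_const: "comm_ring_hom \<phi> \<Longrightarrow> pm_eval \<phi> v (Poly_Mapping.single 0 c) = \<phi> c"
proof -
  assume "comm_ring_hom \<phi>"
  then interpret \<phi>: comm_ring_hom \<phi> .
  show ?thesis by (simp add: pm_eval_def)
qed

lemma pm_eval_pvar:
  assumes "comm_ring_hom \<phi>"
  shows "pm_eval \<phi> v (pvar i) = v i"
proof -
  interpret \<phi>: comm_ring_hom \<phi> by fact
  have "(\<Prod>j\<in>UNIV. v j ^ Poly_Mapping.lookup (Poly_Mapping.single i 1) j) = (\<Prod>j\<in>UNIV. if j = i then v i else 1)"
    by (rule prod.cong) (auto simp: lookup_single when_def)
  also have "\<dots> = v i" by simp
  finally show ?thesis by (simp add: pm_eval_def pvar_def)
qed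

lemma pm_eval_comp:
  assumes "comm_ring_hom s"
  shows "s (pm_eval \<phi> v f) = pm_eval (s \<circ> \<phi>) (s \<circ> v) f"
proof -
  interpret s: comm_ring_hom s by fact
  show ?thesis by (simp add: pm_eval_def s.hom_sum s.hom_mult s.hom_prod s.hom_power)
qed

lemma const_hom: "comm_ring_hom (\<lambda>c. Poly_Mapping.single 0 c :: 'k::comm_ring_1 poly4)"
  by unfold_locales (auto simp: single_one mult_single single_add)

lemma prod_pvar_power:
  "(\<Prod>i\<in>A. pvar i ^ e i) = Poly_Mapping.single (\<Sum>i\<in>A. Poly_Mapping.single i (e i)) 1"
proof -
  have pow: "pvar i ^ n = Poly_Mapping.single (Poly_Mapping.single i n) 1" for i n
    by (induction n) (auto simp: pvar_def mult_single single_one single_add[symmetric])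
  show ?thesis
    by (induction A rule: infinite_finite_induct) (auto simp: pow mult_single single_one)
qed

lemma pm_eval_id: "pm_eval (Poly_Mapping.single 0) pvar f = f"
proof -
  have mono: "(\<Prod>i\<in>UNIV. pvar i ^ Poly_Mapping.lookup m i) = Poly_Mapping.single m 1" for m :: "4 \<Rightarrow>\<^sub>0 nat"
  proof -
    have "(\<Sum>i\<in>UNIV. Poly_Mapping.single i (Poly_Mapping.lookup m i)) = m"
      by (rule poly_mapping_eqI) (simp add: lookup_sum lookup_single when_def)
    then show ?thesis by (simp add: prod_pvar_power)
  qed
  then show ?thesis
    by (simp add: pm_eval_def mono mult_single poly_mapping_as_sum[symmetric])
qed

text \<open>Reduces a comparison of two substitutions modulo \<open>l\<close> to the four
  variables.\<close>

lemma dvd_pm_eval_diff: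
  fixes v w :: "4 \<Rightarrow> 'a::comm_ring_1"
  assumes "\<And>i. l dvd v i - w i"
  shows "l dvd pm_eval \<phi> v f - pm_eval \<phi> w f"
proof -
  have mult: "l dvd a * b - a' * b'" if "l dvd a - a'" "l dvd b - b'" for a b a' b' :: 'a
  proof -
    have "a * b - a' * b' = (a - a') * b + a' * (b - b')" by (simp add: algebra_simps)
    then show ?thesis using that by simp
  qed
  have "l dvd v i ^ n - w i ^ n" for i n
    using assms[of i] by (induction n) (auto intro: mult)
  then have "l dvd (\<Prod>i\<in>A. v i ^ e i) - (\<Prod>i\<in>A. w i ^ e i)" for A and e :: "4 \<Rightarrow> nat"
    by (induction A rule: infinite_finite_induct) (auto intro: mult)
  then show ?thesis unfolding pm_eval_def sum_subtractf[symmetric]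
    by (intro dvd_sum mult) auto
qed

lemma linear_form_expansion:
  assumes "l \<in> poly4_component 1"
  shows "l = (\<Sum>i\<in>UNIV. Poly_Mapping.single 0 (linear_coeffs l i) * pvar i)"
proof (rule poly_mapping_eqI)
  fix m
  have "Poly_Mapping.lookup (\<Sum>i\<in>UNIV. Poly_Mapping.single 0 (linear_coeffs l i) * pvar i) m
      = (\<Sum>i\<in>UNIV. if Poly_Mapping.single i 1 = m then linear_coeffs l i else 0)"
    by (simp add: lookup_sum pvar_def mult_single lookup_single when_def)
  also have "\<dots> = Poly_Mapping.lookup l m"
  proof (cases "monom_deg m = 1")
    case False
    then have "Poly_Mapping.lookup l m = 0" using assms by (force simp: poly4_component_def in_keys_iff)
    moreover have "Poly_Mapping.single i 1 \<noteq> m" for i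
      using False by (auto simp: monom_deg_single)
    ultimately show ?thesis by simp
  next
    case True
    then obtain i where i: "Poly_Mapping.lookup m i \<noteq> 0"
      by (metis monom_deg_def sum.neutral zero_neq_one)
    have *: "1 = Poly_Mapping.lookup m i + (\<Sum>j\<in>UNIV - {i}. Poly_Mapping.lookup m j)"
      using True by (simp add: monom_deg_def sum.remove[of UNIV i])
    then have "Poly_Mapping.lookup m i = 1" using i by linarith
    moreover have "Poly_Mapping.lookup m j = 0" if "j \<noteq> i" for j
    proof -
      have "(\<Sum>j\<in>UNIV - {i}. Poly_Mapping.lookup m j) = 0" using * i by linarith
      then show ?thesis using that by simp
    qed
    ultimately have m: "m = Poly_Mapping.single i 1"
      by (intro poly_mapping_eqI) (auto simp: lookup_single when_def)
    have "(\<Sum>j\<in>UNIV. if Poly_Mapping.single j 1 = m then linear_coeffs l j else 0)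
        = (\<Sum>j\<in>UNIV. if j = i then linear_coeffs l i else 0)"
      by (rule sum.cong) (auto simp: m dest!: arg_cong[of _ _ "\<lambda>m. Poly_Mapping.lookup m i"]
          simp: lookup_single when_def split: if_splits)
    then show ?thesis by (simp add: m linear_coeffs_def)
  qed
  finally show "Poly_Mapping.lookup l m = Poly_Mapping.lookup (\<Sum>i\<in>UNIV. Poly_Mapping.single 0 (linear_coeffs l i) * pvar i) m"
    by simp
qed

section \<open>Syzygies and socle elements modulo a linear form\<close>

text \<open>\<open>g\<close> and \<open>h\<close> are syzygies of the \<open>F j\<close> only modulo
  \<open>l\<close>. Contracting their minors \<open>M\<close> with \<open>F\<close> gives
  \<open>l * v\<close>, and \<open>v\<close> is an honest relation of the \<open>F i\<close>, so
  \<open>v\<close> comes from an alternating \<open>W\<close>. Then \<open>M - l * W\<close> is a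
  Koszul 2-cycle in R, hence a combination of the \<open>F k\<close>, and for degree reasons this
  combination contributes nothing to the degree of the minor.\<close>

lemma minors_dvd:
  fixes F g h :: "nat \<Rightarrow> 'k::comm_ring_1 poly4" and d :: "nat \<Rightarrow> int"
  assumes reg: "regular_upto n F" and F: "\<And>j. j < n \<Longrightarrow> F j \<in> poly4_component (d j)"
    and l: "l \<in> poly4_component s"
    and g: "\<And>j. j < n \<Longrightarrow> g j \<in> poly4_component (a - d j)" "(\<Sum>j<n. g j * F j) = l * p"
    and h: "\<And>j. j < n \<Longrightarrow> h j \<in> poly4_component (b - d j)" "(\<Sum>j<n. h j * F j) = l * q"
    and deg: "\<And>i j k. i < n \<Longrightarrow> j < n \<Longrightarrow> k < n \<Longrightarrow> i \<noteq> j \<Longrightarrow> i \<noteq> k \<Longrightarrow> j \<noteq> k \<Longrightarrow> a + b < d i + d j + d k"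
    and ij: "i < n" "j < n"
  shows "l dvd g i * h j - g j * h i"
proof (cases "i = j")
  case False
  define M where "M i j = g i * h j - g j * h i" for i j
  define v where "v i = g i * q - h i * p" for i
  have Mv: "(\<Sum>j<n. M i j * F j) = l * v i" for i
  proof -
    have "(\<Sum>j<n. M i j * F j) = g i * (\<Sum>j<n. h j * F j) - h i * (\<Sum>j<n. g j * F j)"
      by (simp add: M_def sum_distrib_left sum_subtractf algebra_simps)
    then show ?thesis unfolding g(2) h(2) by (simp add: v_def algebra_simps)
  qed
  have "(\<Sum>i<n. v i * F i) = q * (\<Sum>i<n. g i * F i) - p * (\<Sum>i<n. h i * F i)"
    by (simp add: v_def sum_distrib_left sum_subtractf algebra_simps)
  also have "\<dots> = 0" unfolding g(2) h(2) by (simp add: ac_simps)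
  finally obtain W where W: "\<And>i j. W j i = - W i j" "\<And>i. W i i = 0"
      "\<And>i. i < n \<Longrightarrow> v i = (\<Sum>j<n. W i j * F j)"
    using koszul_exact_1[OF reg] by blast
  obtain E where E: "\<And>i j. i < n \<Longrightarrow> j < n \<Longrightarrow> M i j - l * W i j = (\<Sum>k<n. E i j k * F k)"
      "\<And>i j. i < n \<Longrightarrow> j < n \<Longrightarrow> E i j i = 0 \<and> E i j j = 0"
  proof -
    have "M j i - l * W j i = - (M i j - l * W i j)" for i j
      using W(1)[of i j] by (simp add: M_def)
    moreover have "M i i - l * W i i = 0" for i using W(2)[of i] by (simp add: M_def)
    moreover have "(\<Sum>j<n. (M i j - l * W i j) * F j) = 0" if "i < n" for i
    proof -
      have "(\<Sum>j<n. (M i j - l * W i j) * F j) = (\<Sum>j<n. M i j * F j) - l * (\<Sum>j<n. W i j * F j)"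
        by (simp add: sum_distrib_left sum_subtractf algebra_simps)
      then show ?thesis using W(3)[OF that] Mv by simp
    qed
    ultimately show ?thesis
      using koszul_exact_2[OF reg, of "\<lambda>i j. M i j - l * W i j"] that by blast
  qed
  define t where "t = a + b - d i - d j"
  have "M i j \<in> poly4_component t"
    unfolding M_def t_def
    using component_mult[OF g(1)[OF ij(1)] h(1)[OF ij(2)]] component_mult[OF g(1)[OF ij(2)] h(1)[OF ij(1)]]
    by (intro component_diff) (simp_all add: algebra_simps)
  moreover have "M i j = W i j * l + (\<Sum>k<n. E i j k * F k)" using E(1)[OF ij] by (simp add: algebra_simps)
  ultimately have "M i j = hcomp t (W i j * l + (\<Sum>k<n. E i j k * F k))" by (metis hcomp_id)
  \<comment> \<open>In degree \<open>t\<close> the coefficient of \<open>F k\<close> has degree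
    \<open>a + b - d i - d j - d k\<close>, which is negative for \<open>k\<close> different from
    \<open>i\<close> and \<open>j\<close>; for \<open>k = i\<close> and \<open>k = j\<close> it is
    zero by the choice of \<open>E\<close>.\<close>
  also have "\<dots> = hcomp (t - s) (W i j) * l + (\<Sum>k<n. hcomp (t - d k) (E i j k) * F k)"
    by (simp add: hcomp_add hcomp_sum hcomp_mult[OF l] hcomp_mult[OF F])
  also have "(\<Sum>k<n. hcomp (t - d k) (E i j k) * F k) = 0"
  proof (rule sum.neutral, safe)
    fix k assume k: "k < n"
    show "hcomp (t - d k) (E i j k) * F k = 0"
    proof (cases "k = i \<or> k = j")
      case True
      then show ?thesis using E(2)[OF ij] by (auto simp: hcomp_zero)
    next
      case k': False
      then have "t - d k < 0" using deg[OF ij k] False by (auto simp: t_def)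
      then show ?thesis using component_neg[OF hcomp_in] by (metis mult_zero_left)
    qed
  qed
  finally show ?thesis by (simp add: M_def)
qed simp

section \<open>The quotient by a linear form as a polynomial ring in three variables\<close>

lemma eval_map_poly_hom:
  assumes "comm_ring_hom h"
  shows "comm_ring_hom (\<lambda>p. poly (map_poly h p) v)"
proof -
  interpret h: comm_ring_hom h by fact
  interpret m: map_poly_comm_ring_hom h ..
  show ?thesis by unfold_locales (auto simp: m.hom_add m.hom_mult)
qed

lemma eval_map_poly_const:
  assumes "comm_ring_hom h"
  shows "poly (map_poly h [:a:]) v = h a"
proof -
  interpret h: comm_ring_hom h by fact
  interpret m: map_poly_comm_ring_hom h ..
  show ?thesis by (cases "a = 0") (simp_all add: map_poly_pCons)
qed

lemma eval_map_poly_var: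
  assumes "comm_ring_hom h"
  shows "poly (map_poly h [:0, 1:]) v = v"
proof -
  interpret h: comm_ring_hom h by fact
  interpret m: map_poly_comm_ring_hom h ..
  show ?thesis by (simp add: map_poly_pCons)
qed

text \<open>A variable with nonzero coefficient in \<open>l\<close> is eliminated. The result is
  stated as a surjection with kernel \<open>(l)\<close>, together with linear forms above the three
  coordinates, so that degrees can be counted in R while factoriality is used in the image.\<close>

lemma quotient_by_linear_form:
  fixes l :: "'k::field poly4"
  assumes l: "l \<in> poly4_component 1" "l \<noteq> 0"
  obtains \<psi> :: "'k poly4 \<Rightarrow> 'k poly poly poly" and x y z :: "'k poly4"
  where "comm_ring_hom \<psi>" "surj \<psi>" "\<And>f. \<psi> f = 0 \<longleftrightarrow> l dvd f"
    "x \<in> poly4_component 1" "y \<in> poly4_component 1" "z \<in> poly4_component 1"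
    "\<psi> x = [:0, 1:]" "\<psi> y = [:[:0, 1:]:]" "\<psi> z = [:[:[:0, 1:]:]:]"
proof -
  define c where "c = linear_coeffs l"
  have lc: "l = (\<Sum>i\<in>UNIV. Poly_Mapping.single 0 (c i) * pvar i)"
    unfolding c_def by (rule linear_form_expansion[OF l(1)])
  obtain m where m: "c m \<noteq> 0"
  proof (rule ccontr)
    assume "\<not> thesis"
    then have "c i = 0" for i using that by blast
    then have "l = 0" using lc by simp
    then show False using l(2) by simp
  qed
  have "card (UNIV - {m}) = 3" by (simp add: card_Diff_singleton)
  then obtain i1 i2 i3 where i: "UNIV - {m} = {i1, i2, i3}" "i1 \<noteq> i2" "i1 \<noteq> i3" "i2 \<noteq> i3"
    unfolding card_3_iff by blast
  then have im: "i1 \<noteq> m" "i2 \<noteq> m" "i3 \<noteq> m" by blast+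
  have U: "UNIV = {i1, i2, i3, m}" using i(1) by blast
  define K :: "'k \<Rightarrow> 'k poly poly poly" where "K a = [:[:[:a:]:]:]" for a
  define vx :: "'k poly poly poly" where "vx = [:0, 1:]"
  define vy :: "'k poly poly poly" where "vy = [:[:0, 1:]:]"
  define vz :: "'k poly poly poly" where "vz = [:[:[:0, 1:]:]:]"
  \<comment> \<open>\<open>pvar m\<close> is sent to the value that makes the image of
    \<open>l\<close> zero.\<close>
  define v where "v i = (if i = i1 then vx else if i = i2 then vy else if i = i3 then vz
     else K (- 1 / c m) * (K (c i1) * vx + K (c i2) * vy + K (c i3) * vz))" for i
  have K: "comm_ring_hom K" by unfold_locales (simp_all add: K_def one_pCons[symmetric])
  interpret K: comm_ring_hom K by (rule K)
  define \<psi> where "\<psi> = pm_eval K v"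
  have \<psi>: "comm_ring_hom \<psi>" unfolding \<psi>_def by (rule pm_eval_hom[OF K])
  interpret \<psi>: comm_ring_hom \<psi> by (rule \<psi>)
  have \<psi>v: "\<psi> (pvar i) = v i" for i unfolding \<psi>_def by (rule pm_eval_pvar[OF K])
  have \<psi>c: "\<psi> (Poly_Mapping.single 0 a) = K a" for a unfolding \<psi>_def by (rule pm_eval_const[OF K])
  \<comment> \<open>\<open>s\<close> substitutes the three remaining variables back, one nesting
    level at a time. Modulo \<open>l\<close> it inverts \<open>\<psi>\<close>:
    \<open>s (\<psi> f)\<close> and \<open>f\<close> differ by a multiple of \<open>l\<close>, which
    determines the kernel.\<close>
  define h1 :: "'k poly \<Rightarrow> 'k poly4" where "h1 p = poly (map_poly (Poly_Mapping.single 0) p) (pvar i3)" for p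
  define h2 where "h2 p = poly (map_poly h1 p) (pvar i2)" for p
  define s where "s p = poly (map_poly h2 p) (pvar i1)" for p
  have h1: "comm_ring_hom h1" unfolding h1_def[abs_def] by (rule eval_map_poly_hom[OF const_hom])
  have h2: "comm_ring_hom h2" unfolding h2_def[abs_def] by (rule eval_map_poly_hom[OF h1])
  have s: "comm_ring_hom s" unfolding s_def[abs_def] by (rule eval_map_poly_hom[OF h2])
  interpret C: comm_ring_hom "\<lambda>c. Poly_Mapping.single 0 c :: 'k poly4" by (rule const_hom)
  interpret h1: comm_ring_hom h1 by (rule h1)
  interpret h2: comm_ring_hom h2 by (rule h2)
  interpret s: comm_ring_hom s by (rule s)
  have h1c: "h1 [:a:] = Poly_Mapping.single 0 a" for a by (simp add: h1_def eval_map_poly_const[OF const_hom])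
  have h2c: "h2 [:p:] = h1 p" for p by (simp add: h2_def eval_map_poly_const[OF h1])
  have sc: "s [:p:] = h2 p" for p by (simp add: s_def eval_map_poly_const[OF h2])
  have sK: "s (K a) = Poly_Mapping.single 0 a" for a by (simp add: K_def sc h2c h1c)
  have sX: "s vx = pvar i1" by (simp add: vx_def s_def eval_map_poly_var[OF h2])
  have sY: "s vy = pvar i2" by (simp add: vy_def sc h2_def eval_map_poly_var[OF h1])
  have sZ: "s vz = pvar i3" by (simp add: vz_def sc h2c h1_def eval_map_poly_var[OF const_hom])
  have l4: "l = Poly_Mapping.single 0 (c i1) * pvar i1 + Poly_Mapping.single 0 (c i2) * pvar i2
        + Poly_Mapping.single 0 (c i3) * pvar i3 + Poly_Mapping.single 0 (c m) * pvar m"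
    using i im by (subst lc) (simp add: U add.assoc)
  have unit: "K (c m) * K (- 1 / c m) = - 1"
    using m by (simp add: K.hom_mult[symmetric] K.hom_uminus)
  have unit': "Poly_Mapping.single 0 (- 1 / c m) * Poly_Mapping.single 0 (c m) = (- 1 :: 'k poly4)"
    using m by (simp add: mult_single single_uminus single_one)
  have "l dvd s (v i) - pvar i" for i
  proof -
    consider "i = i1" | "i = i2" | "i = i3" | "i = m" using U by blast
    then show ?thesis
    proof cases
      case 4
      have "s (v m) - pvar m = Poly_Mapping.single 0 (- 1 / c m) * (Poly_Mapping.single 0 (c i1) * pvar i1
          + Poly_Mapping.single 0 (c i2) * pvar i2 + Poly_Mapping.single 0 (c i3) * pvar i3)
          + (Poly_Mapping.single 0 (- 1 / c m) * Poly_Mapping.single 0 (c m)) * pvar m"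
        using im unfolding unit' by (simp add: v_def s.hom_mult s.hom_add sK sX sY sZ)
      also have "\<dots> = Poly_Mapping.single 0 (- 1 / c m) * l" by (simp add: l4 distrib_left mult.assoc)
      finally show ?thesis using 4 by simp
    qed (use i in \<open>simp_all add: v_def sX sY sZ\<close>)
  qed
  then have "l dvd pm_eval (Poly_Mapping.single 0) (s \<circ> v) f - pm_eval (Poly_Mapping.single 0) pvar f" for f
    by (intro dvd_pm_eval_diff) simp
  moreover have "s (\<psi> f) = pm_eval (Poly_Mapping.single 0) (s \<circ> v) f" for f
    unfolding \<psi>_def pm_eval_comp[OF s] by (simp add: comp_def sK)
  ultimately have sec: "l dvd s (\<psi> f) - f" for f by (simp add: pm_eval_id)
  have "\<psi> l = K (c i1) * vx + K (c i2) * vy + K (c i3) * vz + (K (c m) * K (- 1 / c m)) * (K (c i1) * vx + K (c i2) * vy + K (c i3) * vz)"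
    using i im by (simp add: l4 \<psi>.hom_add \<psi>.hom_mult \<psi>v \<psi>c v_def mult.assoc)
  then have "\<psi> l = 0" unfolding unit by simp
  then have "\<psi> f = 0" if "l dvd f" for f using that by (auto simp: \<psi>.hom_mult dvd_def)
  moreover have "l dvd f" if "\<psi> f = 0" for f using sec[of f] by (simp add: that)
  ultimately have ker: "\<psi> f = 0 \<longleftrightarrow> l dvd f" for f by blast
  have surj: "surj \<psi>"
  proof -
    have add: "p + q \<in> range \<psi>" if "p \<in> range \<psi>" "q \<in> range \<psi>" for p q
      using that by (auto simp: \<psi>.hom_add[symmetric])
    have mult: "p * q \<in> range \<psi>" if "p \<in> range \<psi>" "q \<in> range \<psi>" for p q
      using that by (auto simp: \<psi>.hom_mult[symmetric])
    have vx: "vx \<in> range \<psi>" using \<psi>v[of i1] by (auto simp: v_def intro: range_eqI[OF sym])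
    have vy: "vy \<in> range \<psi>" using \<psi>v[of i2] i by (auto simp: v_def intro: range_eqI[OF sym])
    have vz: "vz \<in> range \<psi>" using \<psi>v[of i3] i by (auto simp: v_def intro: range_eqI[OF sym])
    have r1: "[:[:p:]:] \<in> range \<psi>" for p
    proof (induction p)
      case 0
      show ?case using \<psi>.hom_zero by (metis pCons_0_0 rangeI)
    next
      case (pCons a p)
      have "[:[:pCons a p:]:] = K a + vz * [:[:p:]:]" by (simp add: K_def vz_def)
      then show ?case using add[OF _ mult[OF vz pCons.IH]] \<psi>c[of a] by (metis rangeI)
    qed
    have r2: "[:p:] \<in> range \<psi>" for p
    proof (induction p)
      case 0
      show ?case using \<psi>.hom_zero by (metis pCons_0_0 rangeI)
    next
      case (pCons a p)
      have "[:pCons a p:] = [:[:a:]:] + vy * [:p:]" by (simp add: vy_def)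
      then show ?case using add[OF r1 mult[OF vy pCons.IH]] by simp
    qed
    have "p \<in> range \<psi>" for p
    proof (induction p)
      case 0
      show ?case using \<psi>.hom_zero by (metis rangeI)
    next
      case (pCons a p)
      have "pCons a p = [:a:] + vx * p" by (simp add: vx_def)
      then show ?case using add[OF r2 mult[OF vx pCons.IH]] by simp
    qed
    then show ?thesis by blast
  qed
  have "\<psi> (pvar i1) = [:0, 1:]" "\<psi> (pvar i2) = [:[:0, 1:]:]" "\<psi> (pvar i3) = [:[:[:0, 1:]:]:]"
    using i by (simp_all add: \<psi>v v_def vx_def vy_def vz_def)
  then show thesis using that[OF \<psi> surj ker pvar_component pvar_component pvar_component] by blast
qed

lemma hcomp_sum_mult:
  assumes "\<And>j. j \<in> A \<Longrightarrow> F j \<in> poly4_component (d j)"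
  shows "hcomp t (\<Sum>j\<in>A. G j * F j) = (\<Sum>j\<in>A. hcomp (t - d j) (G j) * F j)"
  unfolding hcomp_sum by (rule sum.cong) (auto simp: hcomp_mult[OF assms])

text \<open>R/(F, l) has no socle in degree \<open>e\<close>: \<open>minors_dvd\<close> shows that
  the syzygies \<open>a * k a' - a' * k a\<close> are proportional modulo \<open>l\<close>, and
  \<open>rank_one_socle\<close> concludes in R/l. These syzygies have total degree
  \<open>e + 2\<close>, one for each of the two linear forms, whence \<open>2 * (e + 2)\<close> in
  the degree condition.\<close>

lemma socle_mod_linear_form:
  fixes F :: "nat \<Rightarrow> 'k::field poly4" and d :: "nat \<Rightarrow> int"
  assumes reg: "regular_upto n F" and F: "\<And>j. j < n \<Longrightarrow> F j \<in> poly4_component (d j)"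
    and l: "l \<in> poly4_component 1" "l \<noteq> 0" and u: "u \<in> poly4_component e"
    and soc: "\<And>a. a \<in> poly4_component 1 \<Longrightarrow> \<exists>b G. a * u = l * b + (\<Sum>j<n. G j * F j)"
    and deg: "\<And>i j k. i < n \<Longrightarrow> j < n \<Longrightarrow> k < n \<Longrightarrow> i \<noteq> j \<Longrightarrow> i \<noteq> k \<Longrightarrow> j \<noteq> k \<Longrightarrow>
      2 * (e + 2) < d i + d j + d k"
  shows "\<exists>b G. u = l * b + (\<Sum>j<n. G j * F j)"
proof -
  obtain \<psi> :: "'k poly4 \<Rightarrow> 'k poly poly poly" and x y z
    where \<psi>: "comm_ring_hom \<psi>" "surj \<psi>" "\<And>f. \<psi> f = 0 \<longleftrightarrow> l dvd f"
    and lin: "x \<in> poly4_component 1" "y \<in> poly4_component 1" "z \<in> poly4_component 1"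
    and img: "\<psi> x = [:0, 1:]" "\<psi> y = [:[:0, 1:]:]" "\<psi> z = [:[:[:0, 1:]:]:]"
    by (rule quotient_by_linear_form[OF l]) (rule that)
  interpret \<psi>: comm_ring_hom \<psi> by (rule \<psi>(1))
  \<comment> \<open>Passing to degree \<open>e + 1\<close> makes the coefficients homogeneous, as
    the degree count requires.\<close>
  have "\<exists>b G. a * u = l * b + (\<Sum>j<n. G j * F j) \<and> (\<forall>j. G j \<in> poly4_component (e + 1 - d j))"
    if a: "a \<in> poly4_component 1" for a
  proof -
    obtain b G where "a * u = l * b + (\<Sum>j<n. G j * F j)" using soc[OF a] by auto
    then have bG: "a * u = b * l + (\<Sum>j<n. G j * F j)" by (simp only: mult.commute[of l])
    have "a * u \<in> poly4_component (e + 1)" using component_mult[OF a u] by (simp add: add.commute)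
    then have "a * u = hcomp (e + 1) (b * l + (\<Sum>j<n. G j * F j))" using bG by (simp add: hcomp_id)
    also have "\<dots> = l * hcomp e b + (\<Sum>j<n. hcomp (e + 1 - d j) (G j) * F j)"
      using hcomp_sum_mult[of "{..<n}" F d "e + 1" G] F
        hcomp_mult[OF l(1), of "e + 1" b]
      by (simp add: hcomp_add mult.commute[of _ l])
    finally show ?thesis
      by (intro exI[of _ "hcomp e b"] exI[of _ "\<lambda>j. hcomp (e + 1 - d j) (G j)"]) (simp add: hcomp_in)
  qed
  note hom = this
  define Q where "Q a bk \<longleftrightarrow> (a \<in> poly4_component 1 \<longrightarrow> a * u = l * fst bk + (\<Sum>j<n. snd bk j * F j) \<and>
      (\<forall>j. snd bk j \<in> poly4_component (e + 1 - d j)))" for a bk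
  have "\<forall>a. \<exists>bk. Q a bk" using hom unfolding Q_def by force
  from choice[OF this] obtain bk where "\<forall>a. Q a (bk a)" ..
  moreover define b k where "b a = fst (bk a)" and "k a = snd (bk a)" for a
  ultimately have bk: "\<And>a. a \<in> poly4_component 1 \<Longrightarrow> a * u = l * b a + (\<Sum>j<n. k a j * F j)"
      "\<And>a j. a \<in> poly4_component 1 \<Longrightarrow> k a j \<in> poly4_component (e + 1 - d j)"
    by (simp_all add: Q_def)
  define H where "H i j = (if i = (0::nat) then x * k y j - y * k x j else if i = 1 then x * k z j - z * k x j
      else y * k z j - z * k y j)" for i j
  have syz: "\<exists>p. (\<Sum>j<n. (a * k a' j - a' * k a j) * F j) = l * p"
    if "a \<in> poly4_component 1" "a' \<in> poly4_component 1" for a a'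
  proof -
    have "(\<Sum>j<n. (a * k a' j - a' * k a j) * F j) = a * (\<Sum>j<n. k a' j * F j) - a' * (\<Sum>j<n. k a j * F j)"
      by (simp add: sum_distrib_left sum_subtractf algebra_simps)
    also have "\<dots> = a * (a' * u - l * b a') - a' * (a * u - l * b a)"
      using bk(1)[OF that(1)] bk(1)[OF that(2)] by simp
    also have "\<dots> = l * (a' * b a - a * b a')" by (simp add: algebra_simps)
    finally show ?thesis by blast
  qed
  have Hc: "a * k a' j - a' * k a j \<in> poly4_component (e + 2 - d j)"
    if "a \<in> poly4_component 1" "a' \<in> poly4_component 1" for a a' j
    using component_mult[OF that(1) bk(2)[OF that(2)]] component_mult[OF that(2) bk(2)[OF that(1)]]
    by (intro component_diff) (simp_all add: algebra_simps)
  have H: "\<exists>p. (\<Sum>j<n. H i j * F j) = l * p" "H i j \<in> poly4_component (e + 2 - d j)" for i j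
    using syz[OF lin(1,2)] syz[OF lin(1,3)] syz[OF lin(2,3)] Hc lin
    by (cases "i = 0"; cases "i = 1"; auto simp: H_def)+
  have "l dvd H p i * H q j - H p j * H q i" if "i < n" "j < n" for p q i j
  proof -
    obtain P Q where "(\<Sum>j<n. H p j * F j) = l * P" "(\<Sum>j<n. H q j * F j) = l * Q" using H(1) by metis
    then show ?thesis
      by (intro minors_dvd[OF reg _ l(1), where d = d and a = "e + 2" and b = "e + 2" and p = P and q = Q])
        (use F H(2) deg that in simp_all)
  qed
  then have minors: "\<psi> (H p i) * \<psi> (H q j) = \<psi> (H p j) * \<psi> (H q i)" if "i < n" "j < n" for p q i j
    using that \<psi>(3) by (metis \<psi>.hom_minus \<psi>.hom_mult eq_iff_diff_eq_0)
  have \<psi>l: "\<psi> l = 0" using \<psi>(3) by simp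
  have rel: "\<psi> a * \<psi> u = (\<Sum>j<n. \<psi> (k a j) * \<psi> (F j))" if "a \<in> poly4_component 1" for a
    using arg_cong[OF bk(1)[OF that], of \<psi>] by (simp add: \<psi>.hom_mult \<psi>.hom_add \<psi>.hom_sum \<psi>l)
  have "\<exists>w. \<psi> u = (\<Sum>j<n. w j * \<psi> (F j))"
  proof (rule rank_one_socle[where h = "\<lambda>i j. \<psi> (H i j)" and x = "\<psi> x" and y = "\<psi> y" and z = "\<psi> z"])
    show "\<psi> x \<noteq> 0" unfolding img by (rule poly3_coordinates)
    show "\<psi> x dvd v" if "\<psi> y * v = \<psi> x * w" for v w
      using that unfolding img by (rule poly3_coordinates)
    show "\<exists>a' b'. v = \<psi> x * a' + \<psi> y * b'" if "\<psi> z * v = \<psi> x * a + \<psi> y * b" for v a b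
      using that unfolding img by (rule poly3_coordinates)
  qed (use rel[OF lin(1)] rel[OF lin(2)] rel[OF lin(3)] minors in
      \<open>auto simp: H_def \<psi>.hom_minus \<psi>.hom_mult\<close>)
  then obtain w where w: "\<psi> u = (\<Sum>j<n. w j * \<psi> (F j))" ..
  define W where "W j = inv_into UNIV \<psi> (w j)" for j
  have W: "\<psi> (W j) = w j" for j unfolding W_def by (rule surj_f_inv_f[OF \<psi>(2)])
  have "\<psi> (u - (\<Sum>j<n. W j * F j)) = 0"
    by (simp add: \<psi>.hom_minus \<psi>.hom_sum \<psi>.hom_mult w W)
  then obtain b' where "u - (\<Sum>j<n. W j * F j) = l * b'" using \<psi>(3) by (auto simp: dvd_def)
  then have "u = l * b' + (\<Sum>j<n. W j * F j)" by (simp add: diff_eq_eq)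
  then show ?thesis by (intro exI)
qed

section \<open>Linear independence modulo an ideal\<close>

definition klinear :: "('k::comm_ring_1 poly4 \<Rightarrow> 'k) \<Rightarrow> bool" where
  "klinear \<phi> \<longleftrightarrow> (\<forall>f g. \<phi> (f + g) = \<phi> f + \<phi> g) \<and>
     (\<forall>c f. \<phi> (Poly_Mapping.single 0 c * f) = c * \<phi> f)"

definition indep_mod :: "'k::comm_ring_1 poly4 set \<Rightarrow> nat \<Rightarrow> (nat \<Rightarrow> 'k poly4) \<Rightarrow> bool" where
  "indep_mod J n w \<longleftrightarrow>
     (\<forall>c. (\<Sum>j<n. Poly_Mapping.single 0 (c j) * w j) \<in> J \<longrightarrow> (\<forall>j<n. c j = 0))"

lemma indep_modD:
  "indep_mod J n w \<Longrightarrow> (\<Sum>j<n. Poly_Mapping.single 0 (c j) * w j) \<in> J \<Longrightarrow> i < n \<Longrightarrow> c i = 0"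
  unfolding indep_mod_def by blast

definition ideal_set :: "'a::comm_ring_1 set \<Rightarrow> bool" where
  "ideal_set J \<longleftrightarrow> 0 \<in> J \<and> (\<forall>f\<in>J. \<forall>g\<in>J. f + g \<in> J) \<and> (\<forall>f\<in>J. \<forall>g. g * f \<in> J)"

lemma ideal_set_zero: "ideal_set J \<Longrightarrow> 0 \<in> J"
  and ideal_set_add: "ideal_set J \<Longrightarrow> f \<in> J \<Longrightarrow> g \<in> J \<Longrightarrow> f + g \<in> J"
  and ideal_set_mult: "ideal_set J \<Longrightarrow> f \<in> J \<Longrightarrow> g * f \<in> J"
  unfolding ideal_set_def by blast+

lemma ideal_set_uminus: "ideal_set J \<Longrightarrow> f \<in> J \<Longrightarrow> - f \<in> J"
  using ideal_set_mult[of J f "- 1"] by simp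

lemma ideal_set_diff: "ideal_set J \<Longrightarrow> f \<in> J \<Longrightarrow> g \<in> J \<Longrightarrow> f - g \<in> J"
  using ideal_set_add[of J f "- g"] ideal_set_uminus[of J g] by simp

lemma ideal_set_sum: "ideal_set J \<Longrightarrow> (\<And>i. i \<in> A \<Longrightarrow> f i \<in> J) \<Longrightarrow> sum f A \<in> J"
  by (induction A rule: infinite_finite_induct) (auto intro: ideal_set_zero ideal_set_add)

lemma poly4_vector_space:
  "vector_space (\<lambda>(c::'k::field) (f::'k poly4). Poly_Mapping.single 0 c * f)"
  by unfold_locales
    (auto simp: algebra_simps single_add mult.assoc[symmetric] mult_single single_one)

lemma klinear_sum: "klinear \<phi> \<Longrightarrow> \<phi> (sum f A) = (\<Sum>i\<in>A. \<phi> (f i))"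
proof -
  assume k: "klinear \<phi>"
  have "\<phi> 0 = 0" using k unfolding klinear_def by (metis mult_zero_left single_zero)
  then show ?thesis using k
    by (induction A rule: infinite_finite_induct) (auto simp: klinear_def)
qed

text \<open>Independence modulo \<open>J\<close> means that a basis of \<open>J\<close> stays
  independent when the \<open>w j\<close> are adjoined; on the enlarged set the functionals can be
  prescribed freely, zero on the basis of \<open>J\<close> and dual on the
  \<open>w j\<close>.\<close>

lemma dual_functionals:
  fixes J :: "'k::field poly4 set"
  assumes J: "ideal_set J" and indep: "indep_mod J n w"
  obtains \<phi> where "\<And>i. klinear (\<phi> i)" "\<And>i f. f \<in> J \<Longrightarrow> \<phi> i f = 0"
    "\<And>i j. i < n \<Longrightarrow> j < n \<Longrightarrow> \<phi> i (w j) = (if i = j then 1 else 0)"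
proof -
  let ?s = "\<lambda>(c::'k) (f::'k poly4). Poly_Mapping.single 0 c * f"
  interpret V: vector_space ?s by (rule poly4_vector_space)
  interpret P: vector_space_pair ?s "(*) :: 'k \<Rightarrow> 'k \<Rightarrow> 'k"
    by unfold_locales (auto simp: algebra_simps)
  obtain B where B: "B \<subseteq> J" "V.independent B" "J \<subseteq> V.span B"
    using V.maximal_independent_subset[of J] by metis
  have spanJ: "V.span B \<subseteq> J"
    by (rule V.span_minimal[OF B(1)])
      (auto simp: V.subspace_def intro: ideal_set_zero[OF J] ideal_set_add[OF J] ideal_set_mult[OF J])
  have notin: "w j \<notin> V.span (B \<union> w ` {..<j})" if j: "j < n" for j
  proof
    \<comment> \<open>\<open>T\<close> is the sum of \<open>J\<close> and the span of the earlier
      \<open>w i\<close>; if \<open>w j\<close> lay in it, there would be a relation modulo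
      \<open>J\<close> in which \<open>w j\<close> has coefficient 1.\<close>
    define T where "T = {f. \<exists>b c. b \<in> J \<and> f = b + (\<Sum>i<j. ?s (c i) (w i))}"
    have TI: "f \<in> T" if "b \<in> J" "f = b + (\<Sum>i<j. ?s (c i) (w i))" for f b c
      using that unfolding T_def by blast
    assume "w j \<in> V.span (B \<union> w ` {..<j})"
    also have "\<dots> \<subseteq> T"
    proof (rule V.span_minimal)
      show "B \<union> w ` {..<j} \<subseteq> T"
      proof
        fix f assume "f \<in> B \<union> w ` {..<j}"
        then consider "f \<in> J" | i where "i < j" "f = w i" using B(1) by blast
        then show "f \<in> T"
        proof cases
          case 1
          then show ?thesis by (rule TI[where c = "\<lambda>_. 0"]) simp
        next
          case 2
          have "(\<Sum>m<j. ?s (if m = i then 1 else 0) (w m)) = (\<Sum>m<j. if m = i then w i else 0)"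
            by (rule sum.cong) (auto simp: single_one)
          then show ?thesis using 2
            by (intro TI[OF ideal_set_zero[OF J], where c = "\<lambda>m. if m = i then 1 else 0"]) simp
        qed
      qed
      show "V.subspace T"
        unfolding V.subspace_def
      proof (intro conjI ballI allI)
        show "0 \<in> T" by (rule TI[OF ideal_set_zero[OF J], where c = "\<lambda>_. 0"]) simp
      next
        fix f g assume "f \<in> T" "g \<in> T"
        then obtain b c b' c' where fg: "f = b + (\<Sum>i<j. ?s (c i) (w i))" "b \<in> J"
          "g = b' + (\<Sum>i<j. ?s (c' i) (w i))" "b' \<in> J" unfolding T_def by blast
        show "f + g \<in> T"
          by (rule TI[OF ideal_set_add[OF J fg(2,4)], where c = "\<lambda>i. c i + c' i"])
            (simp add: fg single_add algebra_simps sum.distrib)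
      next
        fix a f assume "f \<in> T"
        then obtain b c where f: "f = b + (\<Sum>i<j. ?s (c i) (w i))" "b \<in> J" unfolding T_def by blast
        show "?s a f \<in> T"
          by (rule TI[OF ideal_set_mult[OF J f(2), of "Poly_Mapping.single 0 a"], where c = "\<lambda>i. a * c i"])
            (simp add: f distrib_left sum_distrib_left mult.assoc[symmetric] mult_single)
      qed
    qed
    finally obtain b c where bc: "w j = b + (\<Sum>i<j. ?s (c i) (w i))" "b \<in> J" unfolding T_def by blast
    define c' where "c' i = (if i = j then 1 else if i < j then - c i else 0)" for i
    have "(\<Sum>i<n. ?s (c' i) (w i)) = (\<Sum>i<Suc j. ?s (c' i) (w i))"
      by (rule sum.mono_neutral_right) (use j in \<open>auto simp: c'_def\<close>)
    also have "\<dots> = w j - (\<Sum>i<j. ?s (c i) (w i))"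
      by (simp add: c'_def single_one single_uminus sum_negf)
    also have "\<dots> = b" by (simp add: bc(1))
    finally have "c' j = 0" using indep bc(2) j unfolding indep_mod_def by auto
    then show False by (simp add: c'_def)
  qed
  have ind: "m \<le> n \<Longrightarrow> V.independent (B \<union> w ` {..<m}) \<and> inj_on w {..<m} \<and> B \<inter> w ` {..<m} = {}" for m
  proof (induction m)
    case 0
    show ?case using B(2) by simp
  next
    case (Suc m)
    have nin: "w m \<notin> V.span (B \<union> w ` {..<m})" using notin Suc.prems by simp
    then have new: "w m \<notin> B \<union> w ` {..<m}" by (metis V.span_base)
    have eq: "B \<union> w ` {..<Suc m} = insert (w m) (B \<union> w ` {..<m})" by (auto simp: lessThan_Suc)
    have IH: "V.independent (B \<union> w ` {..<m})" "inj_on w {..<m}" "B \<inter> w ` {..<m} = {}"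
      using Suc by simp_all
    have "V.independent (B \<union> w ` {..<Suc m})"
      unfolding eq V.independent_insert using new nin IH(1) by simp
    moreover have "inj_on w {..<Suc m}" "B \<inter> w ` {..<Suc m} = {}"
      using new IH(2,3) by (auto simp: lessThan_Suc)
    ultimately show ?case by simp
  qed
  have "\<exists>g. Vector_Spaces.linear ?s (*) g \<and> (\<forall>x\<in>B \<union> w ` {..<n}. g x = (if i < n \<and> x = w i then 1 else 0))" for i
    using P.linear_independent_extend[of "B \<union> w ` {..<n}" "\<lambda>x. if i < n \<and> x = w i then 1 else 0"] ind by blast
  then obtain \<phi> where \<phi>: "\<And>i. Vector_Spaces.linear ?s (*) (\<phi> i)"
    "\<And>i x. x \<in> B \<union> w ` {..<n} \<Longrightarrow> \<phi> i x = (if i < n \<and> x = w i then 1 else 0)" by metis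
  have lin: "klinear (\<phi> i)" for i
    using \<phi>(1)[of i] unfolding klinear_def by (auto simp: linear_iff_module_hom module_hom_iff)
  have "\<phi> i f = 0" if "f \<in> J" for i f
  proof -
    have "f \<in> V.span B" using that B(3) by blast
    then show ?thesis
    proof (rule V.span_induct)
      show "V.subspace {f. \<phi> i f = 0}"
        using lin[of i] unfolding V.subspace_def klinear_def
        by (metis (mono_tags, lifting) add_0 mem_Collect_eq mult_zero_left mult_zero_right single_zero)
      fix x assume "x \<in> B"
      then have "x \<noteq> w i" if "i < n" using ind[of n] that by auto
      then show "\<phi> i x = 0" using \<phi>(2)[of x i] \<open>x \<in> B\<close> by auto
    qed
  qed
  moreover have "\<phi> i (w j) = (if i = j then 1 else 0)" if "i < n" "j < n" for i j
    using \<phi>(2)[of "w j" i] ind[of n] that by (auto simp: inj_on_eq_iff)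
  ultimately show thesis using that lin by blast
qed

text \<open>An abstraction of polynomial functions of a parameter, so that one openness argument
  covers both the four coefficients of a linear form and the single parameter of a pencil.\<close>

definition function_algebra :: "('a \<Rightarrow> 'k::comm_ring_1) set \<Rightarrow> bool" where
  "function_algebra P \<longleftrightarrow> (\<forall>c. (\<lambda>_. c) \<in> P) \<and>
     (\<forall>p\<in>P. \<forall>q\<in>P. (\<lambda>x. p x + q x) \<in> P \<and> (\<lambda>x. p x * q x) \<in> P)"

lemma function_algebra_const: "function_algebra P \<Longrightarrow> (\<lambda>_. c) \<in> P"
  and function_algebra_mult: "function_algebra P \<Longrightarrow> p \<in> P \<Longrightarrow> q \<in> P \<Longrightarrow> (\<lambda>x. p x * q x) \<in> P"
  unfolding function_algebra_def by blast+

lemma function_algebra_sum: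
  assumes P: "function_algebra P" and f: "\<And>i. i \<in> A \<Longrightarrow> (\<lambda>x. f i x) \<in> P"
  shows "(\<lambda>x. \<Sum>i\<in>A. f i x) \<in> P"
  using f by (induction A rule: infinite_finite_induct) (use P in \<open>auto simp: function_algebra_def\<close>)

lemma function_algebra_prod:
  assumes P: "function_algebra P" and f: "\<And>i. i \<in> A \<Longrightarrow> (\<lambda>x. f i x) \<in> P"
  shows "(\<lambda>x. \<Prod>i\<in>A. f i x) \<in> P"
  using f by (induction A rule: infinite_finite_induct) (use P in \<open>auto simp: function_algebra_def\<close>)

text \<open>Functionals dual to the family at \<open>a0\<close> give a matrix that is the identity
  at \<open>a0\<close> and depends polynomially on \<open>a\<close>. Its determinant is
  \<open>q\<close>: where it does not vanish, a relation modulo \<open>J\<close> would be a kernel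
  vector.\<close>

lemma indep_mod_open:
  fixes J :: "'k::field poly4 set"
  assumes P: "function_algebra P" and J: "ideal_set J" and indep: "indep_mod J n (w a0)"
    and w: "\<And>\<phi> j. klinear \<phi> \<Longrightarrow> j < n \<Longrightarrow> (\<lambda>a. \<phi> (w a j)) \<in> P"
  shows "\<exists>q\<in>P. q a0 \<noteq> 0 \<and> (\<forall>a. q a \<noteq> 0 \<longrightarrow> indep_mod J n (w a))"
proof -
  obtain \<phi> where \<phi>: "\<And>i. klinear (\<phi> i)" "\<And>i f. f \<in> J \<Longrightarrow> \<phi> i f = 0"
    "\<And>i j. i < n \<Longrightarrow> j < n \<Longrightarrow> \<phi> i (w a0 j) = (if i = j then 1 else 0)"
    using dual_functionals[OF J indep] by blast
  define A where "A a = mat n n (\<lambda>(i, j). \<phi> i (w a j))" for a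
  have A: "A a \<in> carrier_mat n n" for a by (simp add: A_def)
  define q where "q a = det (A a)" for a
  have "q = (\<lambda>a. \<Sum>p\<in>{p. p permutes {0..<n}}. of_int (sign p) * (\<Prod>i\<in>{0..<n}. \<phi> i (w a (p i))))"
  proof
    fix a
    have "(\<Prod>i\<in>{0..<n}. A a $$ (i, p i)) = (\<Prod>i\<in>{0..<n}. \<phi> i (w a (p i)))" if "p permutes {0..<n}" for p
      by (rule prod.cong) (use permutes_in_image[OF that] in \<open>auto simp: A_def\<close>)
    then show "q a = (\<Sum>p\<in>{p. p permutes {0..<n}}. of_int (sign p) * (\<Prod>i\<in>{0..<n}. \<phi> i (w a (p i))))"
      unfolding q_def det_def'[OF A] by (intro sum.cong) auto
  qed
  moreover have "(\<lambda>a. \<Sum>p\<in>{p. p permutes {0..<n}}. of_int (sign p) * (\<Prod>i\<in>{0..<n}. \<phi> i (w a (p i)))) \<in> P"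
  proof (rule function_algebra_sum[OF P])
    fix p :: "nat \<Rightarrow> nat" assume "p \<in> {p. p permutes {0..<n}}"
    then have "p i < n" if "i < n" for i using permutes_in_image[of p "{0..<n}" i] that by simp
    then have "(\<lambda>a. \<Prod>i\<in>{0..<n}. \<phi> i (w a (p i))) \<in> P"
      by (intro function_algebra_prod[OF P] w \<phi>(1)) simp
    then show "(\<lambda>a. of_int (sign p) * (\<Prod>i\<in>{0..<n}. \<phi> i (w a (p i)))) \<in> P"
      by (rule function_algebra_mult[OF P function_algebra_const[OF P]])
  qed
  ultimately have "q \<in> P" by simp
  moreover have "A a0 = 1\<^sub>m n" by (rule eq_matI) (auto simp: A_def \<phi>(3))
  then have "q a0 \<noteq> 0" by (simp add: q_def)
  moreover have "indep_mod J n (w a)" if q: "q a \<noteq> 0" for a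
    unfolding indep_mod_def
  proof (intro allI impI)
    fix c i assume c: "(\<Sum>j<n. Poly_Mapping.single 0 (c j) * w a j) \<in> J" and i: "i < n"
    have "A a *\<^sub>v vec n c = 0\<^sub>v n"
    proof (rule eq_vecI)
      fix k assume "k < dim_vec (0\<^sub>v n :: 'k vec)"
      then have k: "k < n" by simp
      have "(A a *\<^sub>v vec n c) $ k = (\<Sum>j<n. \<phi> k (w a j) * c j)"
        using k by (simp add: A_def scalar_prod_def atLeast0LessThan)
      also have "\<dots> = \<phi> k (\<Sum>j<n. Poly_Mapping.single 0 (c j) * w a j)"
        using \<phi>(1)[of k] by (simp add: klinear_sum klinear_def mult.commute)
      also have "\<dots> = 0" using c by (rule \<phi>(2))
      finally show "(A a *\<^sub>v vec n c) $ k = 0\<^sub>v n $ k" using k by simp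
    qed (simp add: A_def)
    then have "vec n c = 0\<^sub>v n"
      using det_0_iff_vec_prod_zero_field[OF A] q unfolding q_def by (metis vec_carrier)
    then show "c i = 0" using i by (metis index_vec index_zero_vec(1))
  qed
  ultimately show ?thesis by blast
qed

text \<open>Induction on \<open>k\<close> for all functionals at once: one factor of the power is
  expanded, its coefficients are pulled out, and each \<open>y i\<close> is absorbed into the
  functional.\<close>

lemma function_algebra_power_family:
  assumes P: "function_algebra P" and c: "\<And>i. i \<in> A \<Longrightarrow> c i \<in> P" and \<phi>: "klinear \<phi>"
  shows "(\<lambda>a. \<phi> ((\<Sum>i\<in>A. Poly_Mapping.single 0 (c i a) * y i) ^ k * v)) \<in> P"
  using \<phi>
proof (induction k arbitrary: \<phi>)
  case 0
  show ?case using P by (simp add: function_algebra_def)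
next
  case (Suc k)
  let ?b = "\<lambda>a. \<Sum>i\<in>A. Poly_Mapping.single 0 (c i a) * y i"
  have "\<phi> (?b a ^ Suc k * v) = (\<Sum>i\<in>A. c i a * \<phi> (y i * (?b a ^ k * v)))" for a
  proof -
    have "?b a ^ Suc k * v = (\<Sum>i\<in>A. Poly_Mapping.single 0 (c i a) * (y i * (?b a ^ k * v)))"
      by (simp add: sum_distrib_right mult.assoc)
    then show ?thesis using Suc.prems by (simp add: klinear_sum) (simp add: klinear_def)
  qed
  moreover have "(\<lambda>a. \<Sum>i\<in>A. c i a * \<phi> (y i * (?b a ^ k * v))) \<in> P"
  proof (rule function_algebra_sum[OF P])
    fix i assume i: "i \<in> A"
    have "klinear (\<lambda>f. \<phi> (y i * f))"
      using Suc.prems unfolding klinear_def by (simp add: distrib_left mult.left_commute[of "y i"])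
    then have "(\<lambda>a. \<phi> (y i * (?b a ^ k * v))) \<in> P" by (rule Suc.IH)
    then show "(\<lambda>a. c i a * \<phi> (y i * (?b a ^ k * v))) \<in> P"
      by (rule function_algebra_mult[OF P c[OF i]])
  qed
  ultimately show ?case by simp
qed

lemma finite_monom_deg: "finite {m. monom_deg m \<le> e}"
proof -
  have "inj_on (Poly_Mapping.lookup :: (4 \<Rightarrow>\<^sub>0 nat) \<Rightarrow> _) {m. monom_deg m \<le> e}"
    by (auto intro!: inj_onI poly_mapping_eqI dest: fun_cong)
  moreover have "Poly_Mapping.lookup ` {m. monom_deg m \<le> e} \<subseteq> (UNIV :: 4 set) \<rightarrow>\<^sub>E {..e}"
  proof -
    have "Poly_Mapping.lookup m i \<le> monom_deg m" for m i
      unfolding monom_deg_def by (rule member_le_sum) auto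
    then show ?thesis by (auto simp: PiE_UNIV_domain intro: order_trans)
  qed
  ultimately show ?thesis
    by (meson finite finite_PiE finite_atMost finite_imageD finite_subset)
qed

text \<open>Independence modulo \<open>J\<close> implies independence in R, where the monomials
  span. A crude finite bound is enough to make maximal ranks exist; counting degrees up to
  \<open>e\<close> also makes it monotone in \<open>e\<close>, which \<open>pencil_faithful\<close>
  uses.\<close>

lemma indep_mod_bound:
  fixes J :: "'k::field poly4 set"
  assumes J: "0 \<in> J" and indep: "indep_mod J n w" and w: "\<And>j. j < n \<Longrightarrow> w j \<in> poly4_component (int e)"
  shows "n \<le> card {m :: 4 \<Rightarrow>\<^sub>0 nat. monom_deg m \<le> e}"
proof -
  let ?s = "\<lambda>(c::'k) (f::'k poly4). Poly_Mapping.single 0 c * f"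
  interpret V: vector_space ?s by (rule poly4_vector_space)
  have inj: "inj_on w {..<n}"
  proof (rule inj_onI, rule ccontr)
    fix i j assume ij: "i \<in> {..<n}" "j \<in> {..<n}" "w i = w j" "i \<noteq> j"
    define c :: "nat \<Rightarrow> 'k" where "c k = (if k = i then 1 else if k = j then - 1 else 0)" for k
    have "(\<Sum>k<n. ?s (c k) (w k)) = (\<Sum>k\<in>{i, j}. ?s (c k) (w k))"
      by (rule sum.mono_neutral_right) (use ij in \<open>auto simp: c_def\<close>)
    also have "\<dots> = 0" using ij by (simp add: c_def single_uminus single_one)
    finally have "c i = 0" using J indep ij unfolding indep_mod_def by auto
    then show False by (simp add: c_def)
  qed
  have ind: "V.independent (w ` {..<n})"
    unfolding V.independent_explicit_finite_subsets
  proof (intro allI impI ballI)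
    fix S u f assume S: "S \<subseteq> w ` {..<n}" "finite S" "(\<Sum>f\<in>S. ?s (u f) f) = 0" "f \<in> S"
    have "(\<Sum>j<n. ?s (if w j \<in> S then u (w j) else 0) (w j))
        = (\<Sum>f\<in>w ` {..<n}. ?s (if f \<in> S then u f else 0) f)"
      by (rule sum.reindex_cong[OF inj refl, symmetric]) simp
    also have "\<dots> = (\<Sum>f\<in>S. ?s (u f) f)"
      by (rule sum.mono_neutral_cong_right) (use S in auto)
    finally have sum: "(\<Sum>j<n. ?s (if w j \<in> S then u (w j) else 0) (w j)) = 0" using S(3) by simp
    from S(1,4) obtain j where j: "j < n" "f = w j" by blast
    have "(if w j \<in> S then u (w j) else 0) = 0"
      by (rule indep_modD[OF indep _ j(1)]) (simp only: sum J)
    then show "u f = 0" using S(4) j by simp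
  qed
  let ?M = "(\<lambda>m. Poly_Mapping.single m (1::'k)) ` {m. monom_deg m \<le> e}"
  have "w ` {..<n} \<subseteq> V.span ?M"
  proof safe
    fix j assume j: "j < n"
    have "w j = (\<Sum>m\<in>Poly_Mapping.keys (w j). ?s (Poly_Mapping.lookup (w j) m) (Poly_Mapping.single m 1))"
      by (subst poly_mapping_as_sum) (simp add: mult_single)
    also have "\<dots> \<in> V.span ?M"
      using w[OF j] by (intro V.span_sum V.span_scale V.span_base imageI) (auto simp: poly4_component_def)
    finally show "w j \<in> V.span ?M" .
  qed
  then have "card (w ` {..<n}) \<le> card ?M"
    using V.independent_span_bound[OF _ ind] finite_monom_deg[of e] by blast
  also have "\<dots> \<le> card {m :: 4 \<Rightarrow>\<^sub>0 nat. monom_deg m \<le> e}" by (rule card_image_le[OF finite_monom_deg])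
  finally show ?thesis using card_image[OF inj] by simp
qed

section \<open>Linear forms of generic rank\<close>

definition lin :: "(4 \<Rightarrow> 'k::comm_ring_1) \<Rightarrow> 'k poly4" where
  "lin c = (\<Sum>i\<in>UNIV. Poly_Mapping.single 0 (c i) * pvar i)"

lemma lin_component: "lin c \<in> poly4_component 1"
  unfolding lin_def by (intro component_sum component_scale pvar_component)

lemma lin_linear_coeffs: "l \<in> poly4_component 1 \<Longrightarrow> lin (linear_coeffs l) = l"
  unfolding lin_def by (rule linear_form_expansion[symmetric])

lemma linear_coeffs_lin: "linear_coeffs (lin c) = c"
proof
  fix j
  have "(\<Sum>i\<in>UNIV. if Poly_Mapping.single i (1::nat) = Poly_Mapping.single j 1 then c i else 0)
      = (\<Sum>i\<in>UNIV. if i = j then c j else 0)"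
    by (rule sum.cong) (auto dest!: arg_cong[of _ _ "\<lambda>m. Poly_Mapping.lookup m j"]
          simp: lookup_single when_def split: if_splits)
  then show "linear_coeffs (lin c) j = c j"
    by (simp add: linear_coeffs_def lin_def lookup_sum pvar_def mult_single lookup_single when_def)
qed

section \<open>Polynomial functions on the space of linear forms\<close>

lemma poly4_eval_pm_eval: "poly4_eval p a = pm_eval id a p"
  by (simp add: poly4_eval_def pm_eval_def)

lemma id_hom: "comm_ring_hom (id :: 'a::comm_ring_1 \<Rightarrow> 'a)"
  by unfold_locales auto

lemma poly4_eval_add: "poly4_eval (p + q) a = poly4_eval p a + poly4_eval q a"
  and poly4_eval_mult: "poly4_eval (p * q) a = poly4_eval p a * poly4_eval q a"
  and poly4_eval_prod: "poly4_eval (prod f A) a = (\<Prod>i\<in>A. poly4_eval (f i) a)"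
proof -
  interpret ev: comm_ring_hom "pm_eval id a" by (rule pm_eval_hom[OF id_hom])
  show "poly4_eval (p + q) a = poly4_eval p a + poly4_eval q a"
    "poly4_eval (p * q) a = poly4_eval p a * poly4_eval q a"
    "poly4_eval (prod f A) a = (\<Prod>i\<in>A. poly4_eval (f i) a)"
    by (simp_all add: poly4_eval_pm_eval ev.hom_add ev.hom_mult ev.hom_prod)
qed

lemma function_algebra_poly4_eval: "function_algebra (range (poly4_eval :: 'k::comm_ring_1 poly4 \<Rightarrow> _))"
  unfolding function_algebra_def
proof (intro conjI allI ballI)
  fix c :: 'k
  have "(\<lambda>_. c) = poly4_eval (Poly_Mapping.single 0 c)"
    by (simp add: fun_eq_iff poly4_eval_pm_eval pm_eval_const[OF id_hom])
  then show "(\<lambda>_. c) \<in> range poly4_eval" by blast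
next
  fix p q :: "(4 \<Rightarrow> 'k) \<Rightarrow> 'k" assume "p \<in> range poly4_eval" "q \<in> range poly4_eval"
  then obtain f g where fg: "p = poly4_eval f" "q = poly4_eval g" by blast
  have "(\<lambda>x. p x + q x) = poly4_eval (f + g)"
    by (simp add: fun_eq_iff fg poly4_eval_add)
  then show "(\<lambda>x. p x + q x) \<in> range poly4_eval" by blast
  have "(\<lambda>x. p x * q x) = poly4_eval (f * g)"
    by (simp add: fun_eq_iff fg poly4_eval_mult)
  then show "(\<lambda>x. p x * q x) \<in> range poly4_eval" by blast
qed

lemma coordinate_in_range: "(\<lambda>c. c i) \<in> range (poly4_eval :: 'k::comm_ring_1 poly4 \<Rightarrow> _)"
proof -
  have "(\<lambda>c. c i) = poly4_eval (pvar i :: 'k poly4)"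
    by (simp add: fun_eq_iff poly4_eval_pm_eval pm_eval_pvar[OF id_hom])
  then show ?thesis by blast
qed

lemma function_algebra_poly: "function_algebra (range (poly :: 'k::comm_ring_1 poly \<Rightarrow> _))"
  unfolding function_algebra_def
proof (intro conjI allI ballI)
  fix c :: 'k
  have "(\<lambda>_. c) = poly [:c:]" by (simp add: fun_eq_iff)
  then show "(\<lambda>_. c) \<in> range poly" by blast
next
  fix p q :: "'k \<Rightarrow> 'k" assume "p \<in> range poly" "q \<in> range poly"
  then obtain f g where fg: "p = poly f" "q = poly g" by blast
  have "(\<lambda>x. p x + q x) = poly (f + g)" "(\<lambda>x. p x * q x) = poly (f * g)"
    by (simp_all add: fun_eq_iff fg)
  then show "(\<lambda>x. p x + q x) \<in> range poly" "(\<lambda>x. p x * q x) \<in> range poly" by blast+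
qed

lemma poly4_eval_on_line: "\<exists>P. \<forall>s. poly4_eval p (\<lambda>i. a i + s * b i) = poly P s"
proof (intro exI allI)
  fix s
  show "poly4_eval p (\<lambda>i. a i + s * b i)
      = poly (\<Sum>m\<in>Poly_Mapping.keys p. [:Poly_Mapping.lookup p m:] * (\<Prod>i\<in>UNIV. [:a i, b i:] ^ Poly_Mapping.lookup m i)) s"
    by (simp add: poly4_eval_def poly_sum poly_prod poly_power)
qed

lemma poly_common_nonroot:
  fixes Q :: "'k::field_char_0 poly set"
  assumes "finite Q" and "\<And>p. p \<in> Q \<Longrightarrow> p \<noteq> 0"
  shows "\<exists>s. \<forall>p\<in>Q. poly p s \<noteq> 0"
proof -
  have "finite (\<Union>p\<in>Q. {s. poly p s = 0})" using assms by (auto intro: poly_roots_finite)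
  then have "(\<Union>p\<in>Q. {s. poly p s = 0}) \<noteq> UNIV" using infinite_UNIV_char_0 by metis
  then show ?thesis by blast
qed

text \<open>Finitely many nonempty open sets in affine space meet. A point good for \<open>Q\<close>
  and a point good for \<open>q\<close> are joined by a line; restricted to it, each function is a
  nonzero polynomial, as seen at the parameter 0 or 1.\<close>

lemma poly4_common_nonroot:
  fixes Q :: "((4 \<Rightarrow> 'k::field_char_0) \<Rightarrow> 'k) set"
  assumes "finite Q" and "Q \<subseteq> range poly4_eval" and "\<And>q. q \<in> Q \<Longrightarrow> \<exists>c. q c \<noteq> 0"
  shows "\<exists>c. \<forall>q\<in>Q. q c \<noteq> 0"
  using assms
proof (induction Q)
  case (insert q Q)
  then obtain c where c: "\<And>p. p \<in> Q \<Longrightarrow> p c \<noteq> 0" by blast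
  obtain c' where c': "q c' \<noteq> 0" using insert.prems(2) by blast
  have "\<exists>P. \<forall>s. p (\<lambda>i. c i + s * (c' i - c i)) = poly P s" if "p \<in> insert q Q" for p
  proof -
    from insert.prems(1) that obtain f where "p = poly4_eval f" by blast
    then show ?thesis using poly4_eval_on_line[of f c "\<lambda>i. c' i - c i"] by simp
  qed
  then have "\<forall>p\<in>insert q Q. \<exists>P. \<forall>s. p (\<lambda>i. c i + s * (c' i - c i)) = poly P s" by blast
  from bchoice[OF this] obtain P
    where P: "\<And>p s. p \<in> insert q Q \<Longrightarrow> p (\<lambda>i. c i + s * (c' i - c i)) = poly (P p) s" by blast
  have "P p \<noteq> 0" if "p \<in> insert q Q" for p
    using P[OF that, of 0] P[OF that, of 1] c[of p] c' that by auto
  then have "\<exists>s. \<forall>p\<in>P ` insert q Q. poly p s \<noteq> 0"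
    by (intro poly_common_nonroot) (use insert.hyps(1) in auto)
  then obtain s where "\<forall>p\<in>P ` insert q Q. poly p s \<noteq> 0" ..
  then have "\<forall>p\<in>insert q Q. p (\<lambda>i. c i + s * (c' i - c i)) \<noteq> 0" using P by auto
  then show ?case by blast
qed simp

text \<open>The map from degree \<open>e\<close> into R/J given by multiplication with
  \<open>l ^ k\<close> has rank at least \<open>n\<close>, expressed by a witnessing family instead
  of a dimension.\<close>

definition rank_ge :: "'k::comm_ring_1 poly4 set \<Rightarrow> 'k poly4 \<Rightarrow> nat \<Rightarrow> nat \<Rightarrow> nat \<Rightarrow> bool" where
  "rank_ge J l e k n \<longleftrightarrow>
     (\<exists>v. (\<forall>j<n. v j \<in> poly4_component (int e)) \<and> indep_mod J n (\<lambda>j. l ^ k * v j))"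

text \<open>The working notion of a general form: no linear form has larger rank for this degree and
  this exponent.\<close>

definition rank_generic :: "'k::comm_ring_1 poly4 set \<Rightarrow> 'k poly4 \<Rightarrow> nat \<Rightarrow> nat \<Rightarrow> bool" where
  "rank_generic J l e k \<longleftrightarrow> (\<forall>l'\<in>poly4_component 1. \<forall>n. rank_ge J l' e k n \<longrightarrow> rank_ge J l e k n)"

lemma indep_mod_cancel:
  assumes J: "ideal_set J" and indep: "indep_mod J n (\<lambda>j. l * v j)"
  shows "indep_mod J n v"
  unfolding indep_mod_def
proof (intro allI impI)
  fix c i assume c: "(\<Sum>j<n. Poly_Mapping.single 0 (c j) * v j) \<in> J" and i: "i < n"
  have "l * (\<Sum>j<n. Poly_Mapping.single 0 (c j) * v j) \<in> J" by (rule ideal_set_mult[OF J c])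
  then have "(\<Sum>j<n. Poly_Mapping.single 0 (c j) * (l * v j)) \<in> J"
    by (simp add: sum_distrib_left mult.left_commute)
  then show "c i = 0" by (rule indep_modD[OF indep _ i])
qed

lemma rank_ge_bound:
  fixes J :: "'k::field poly4 set"
  assumes J: "ideal_set J" and "rank_ge J l e k n"
  shows "n \<le> card {m :: 4 \<Rightarrow>\<^sub>0 nat. monom_deg m \<le> e}"
proof -
  obtain v where v: "\<And>j. j < n \<Longrightarrow> v j \<in> poly4_component (int e)" "indep_mod J n (\<lambda>j. l ^ k * v j)"
    using assms(2) unfolding rank_ge_def by blast
  show ?thesis
    by (rule indep_mod_bound[OF ideal_set_zero[OF J] indep_mod_cancel[OF J v(2)] v(1)])
qed

lemma rank_ge_open:
  fixes J :: "'k::field poly4 set"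
  assumes J: "ideal_set J" and "rank_ge J (lin c0) e k n"
  shows "\<exists>q\<in>range poly4_eval. q c0 \<noteq> 0 \<and> (\<forall>c. q c \<noteq> 0 \<longrightarrow> rank_ge J (lin c) e k n)"
proof -
  obtain v where v: "\<forall>j<n. v j \<in> poly4_component (int e)" "indep_mod J n (\<lambda>j. lin c0 ^ k * v j)"
    using assms(2) unfolding rank_ge_def by blast
  have "\<exists>q\<in>range poly4_eval. q c0 \<noteq> 0 \<and> (\<forall>c. q c \<noteq> 0 \<longrightarrow> indep_mod J n (\<lambda>j. lin c ^ k * v j))"
  proof (rule indep_mod_open[where w = "\<lambda>c j. lin c ^ k * v j", OF function_algebra_poly4_eval J v(2)])
    fix \<phi> :: "'k poly4 \<Rightarrow> 'k" and j assume \<phi>: "klinear \<phi>"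
    show "(\<lambda>c. \<phi> (lin c ^ k * v j)) \<in> range poly4_eval"
      unfolding lin_def by (rule function_algebra_power_family[OF function_algebra_poly4_eval coordinate_in_range \<phi>])
  qed
  then show ?thesis using v(1) unfolding rank_ge_def by blast
qed

text \<open>For each pair \<open>(e, k)\<close> the greatest rank is attained somewhere, hence on a
  nonempty open set. The bound \<open>N\<close> leaves finitely many pairs, so these sets have a
  common point.\<close>

lemma generic_form_exists:
  fixes J :: "'k::field_char_0 poly4 set"
  assumes J: "ideal_set J"
  shows "\<exists>c. lin c \<noteq> 0 \<and> (\<forall>e\<le>N. \<forall>k\<le>N. rank_generic J (lin c) e k)"
proof -
  have "\<exists>q\<in>range poly4_eval. (\<exists>c. q c \<noteq> 0) \<and> (\<forall>c. q c \<noteq> 0 \<longrightarrow> rank_generic J (lin c) e k)" for e k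
  proof -
    let ?R = "\<lambda>n. \<exists>c. rank_ge J (lin c) e k n"
    have "?R 0" by (simp add: rank_ge_def indep_mod_def)
    moreover have "\<forall>n. ?R n \<longrightarrow> n \<le> card {m :: 4 \<Rightarrow>\<^sub>0 nat. monom_deg m \<le> e}"
      using rank_ge_bound[OF J] by blast
    ultimately have R: "?R (Greatest ?R)" and max: "\<And>n. ?R n \<Longrightarrow> n \<le> Greatest ?R"
      using GreatestI_nat[of ?R 0] Greatest_le_nat[of ?R] by blast+
    from R obtain c0 where "rank_ge J (lin c0) e k (Greatest ?R)" ..
    from rank_ge_open[OF J this] obtain q where q: "q \<in> range poly4_eval" "q c0 \<noteq> 0"
      "\<And>c. q c \<noteq> 0 \<Longrightarrow> rank_ge J (lin c) e k (Greatest ?R)" by blast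
    have mono: "rank_ge J l e k n" if "rank_ge J l e k n'" "n \<le> n'" for l n n'
    proof -
      obtain v where v: "\<forall>j<n'. v j \<in> poly4_component (int e)" "indep_mod J n' (\<lambda>j. l ^ k * v j)"
        using \<open>rank_ge J l e k n'\<close> unfolding rank_ge_def by blast
      have "indep_mod J n (\<lambda>j. l ^ k * v j)"
        unfolding indep_mod_def
      proof (intro allI impI)
        fix c i assume c: "(\<Sum>j<n. Poly_Mapping.single 0 (c j) * (l ^ k * v j)) \<in> J" and i: "i < n"
        have "(\<Sum>j<n'. Poly_Mapping.single 0 (if j < n then c j else 0) * (l ^ k * v j))
            = (\<Sum>j<n. Poly_Mapping.single 0 (c j) * (l ^ k * v j))"
          by (rule sum.mono_neutral_cong_right) (use that in auto)
        then have "(if i < n then c i else 0) = 0"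
          using c i that(2) by (intro indep_modD[OF v(2), of "\<lambda>i. if i < n then c i else 0"]) auto
        then show "c i = 0" using i by simp
      qed
      then show ?thesis using v(1) that(2) unfolding rank_ge_def by (meson less_le_trans)
    qed
    have "rank_generic J (lin c) e k" if "q c \<noteq> 0" for c
      unfolding rank_generic_def
    proof (intro ballI allI impI)
      fix l' n assume "l' \<in> poly4_component 1" "rank_ge J l' e k n"
      then have "?R n" using lin_linear_coeffs[of l'] by metis
      then show "rank_ge J (lin c) e k n" using mono[OF q(3)[OF that]] max by blast
    qed
    then show ?thesis using q by blast
  qed
  then have "\<forall>x. \<exists>q. q \<in> range poly4_eval \<and> (\<exists>c. q c \<noteq> 0) \<and>
      (\<forall>c. q c \<noteq> 0 \<longrightarrow> rank_generic J (lin c) (fst x) (snd x))" by blast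
  from choice[OF this] obtain q where q: "\<And>x. q x \<in> range poly4_eval" "\<And>x. \<exists>c. q x c \<noteq> 0"
     "\<And>x c. q x c \<noteq> 0 \<Longrightarrow> rank_generic J (lin c) (fst x) (snd x)" by blast
  \<comment> \<open>A coordinate function joins the list to force
    \<open>lin c \<noteq> 0\<close>.\<close>
  have coord: "(\<lambda>c. c 0) \<in> range (poly4_eval :: 'k poly4 \<Rightarrow> _)" by (rule coordinate_in_range)
  have "\<exists>c. (\<lambda>c. c 0) c \<noteq> (0 :: 'k)" by (rule exI[of _ "\<lambda>_. 1"]) simp
  then have "\<exists>c. \<forall>p\<in>insert (\<lambda>c. c 0) (q ` ({..N} \<times> {..N})). p c \<noteq> 0"
    by (intro poly4_common_nonroot) (use q(1,2) coord in auto)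
  then obtain c where c: "\<forall>p\<in>insert (\<lambda>c. c 0) (q ` ({..N} \<times> {..N})). p c \<noteq> 0" ..
  then have "rank_generic J (lin c) e k" if "e \<le> N" "k \<le> N" for e k
    using q(3)[of "(e, k)" c] that by auto
  moreover have "lin c \<noteq> 0"
  proof
    assume "lin c = 0"
    then have "linear_coeffs (lin c) 0 = 0" by (simp add: linear_coeffs_def)
    then show False using c by (simp add: linear_coeffs_lin)
  qed
  ultimately show ?thesis by blast
qed

text \<open>First-order deformation of the kernel of \<open>l ^ Suc k\<close> along
  \<open>x s = l + s m\<close>. If \<open>l ^ k * m * a\<close> were outside the image of
  \<open>l ^ Suc k\<close> modulo \<open>J\<close>, it would extend a basis of that image. For
  general \<open>s\<close> the elements \<open>a\<close> and \<open>v j\<close> would then have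
  independent images under \<open>x s ^ Suc k\<close>, so \<open>x s\<close> would have larger rank
  than \<open>l\<close>.\<close>

lemma rank_generic_deform:
  fixes J :: "'k::field_char_0 poly4 set"
  assumes J: "ideal_set J" and l: "l \<in> poly4_component 1" and gen: "rank_generic J l e (Suc k)"
    and m: "m \<in> poly4_component 1" and a: "a \<in> poly4_component (int e)" "l ^ Suc k * a \<in> J"
  shows "\<exists>b\<in>poly4_component (int e). l ^ k * (m * a) - l ^ Suc k * b \<in> J"
proof (rule ccontr)
  assume contra: "\<not> ?thesis"
  define n where "n = Greatest (rank_ge J l e (Suc k))"
  have bound: "\<forall>n. rank_ge J l e (Suc k) n \<longrightarrow> n \<le> card {m :: 4 \<Rightarrow>\<^sub>0 nat. monom_deg m \<le> e}"
    using rank_ge_bound[OF J] by blast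
  have "rank_ge J l e (Suc k) 0" by (simp add: rank_ge_def indep_mod_def)
  then have "rank_ge J l e (Suc k) n" unfolding n_def by (rule GreatestI_nat) (use bound in blast)
  then obtain v where v: "\<And>j. j < n \<Longrightarrow> v j \<in> poly4_component (int e)"
      "indep_mod J n (\<lambda>j. l ^ Suc k * v j)" unfolding rank_ge_def by blast
  define x where "x s = l + Poly_Mapping.single 0 s * m" for s
  \<comment> \<open>\<open>g s\<close> is the difference quotient
    \<open>(x s ^ Suc k - l ^ Suc k) * a / s\<close>, written so that it makes sense at
    \<open>s = 0\<close>, where it is the derivative, \<open>k + 1\<close> times
    \<open>l ^ k * (m * a)\<close>.\<close>
  define g where "g s = (\<Sum>i<Suc k. x s ^ i * (m * l ^ (k - i) * a))" for s
  define w where "w s j = (if j < n then x s ^ Suc k * v j else g s)" for s j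
  have x0: "x 0 = l" by (simp add: x_def)
  have g0: "g 0 = Poly_Mapping.single 0 (of_nat (Suc k)) * (l ^ k * (m * a))"
  proof -
    have "g 0 = (\<Sum>i<Suc k. l ^ k * (m * a))"
      unfolding g_def x0
    proof (rule sum.cong)
      fix i assume "i \<in> {..<Suc k}"
      then have "l ^ i * l ^ (k - i) = l ^ k" by (simp add: power_add[symmetric])
      then show "l ^ i * (m * l ^ (k - i) * a) = l ^ k * (m * a)"
        by (metis (no_types) mult.assoc mult.commute)
    qed simp
    then show ?thesis unfolding single_of_nat by simp
  qed
  have xg: "x s ^ Suc k * a = Poly_Mapping.single 0 s * g s + l ^ Suc k * a" for s
  proof -
    have "x s ^ Suc k - l ^ Suc k = (x s - l) * (\<Sum>i<Suc k. l ^ (Suc k - Suc i) * x s ^ i)"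
      by (rule power_diff_sumr2)
    also have "\<dots> * a = Poly_Mapping.single 0 s * g s"
      by (simp add: x_def[of s] g_def sum_distrib_left sum_distrib_right ac_simps del: sum.lessThan_Suc)
    finally show ?thesis by (simp add: algebra_simps)
  qed
  have indep0: "indep_mod J (Suc n) (w 0)"
    unfolding indep_mod_def
  proof (intro allI impI)
    fix c i assume c: "(\<Sum>j<Suc n. Poly_Mapping.single 0 (c j) * w 0 j) \<in> J" and i: "i < Suc n"
    define d where "d = c n * of_nat (Suc k)"
    have "(\<Sum>j<Suc n. Poly_Mapping.single 0 (c j) * w 0 j)
        = (\<Sum>j<n. Poly_Mapping.single 0 (c j) * (l ^ Suc k * v j)) + Poly_Mapping.single 0 (c n) * g 0"
      by (simp add: w_def x0)
    also have "Poly_Mapping.single 0 (c n) * g 0 = Poly_Mapping.single 0 d * (l ^ k * (m * a))"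
      unfolding g0 d_def by (simp only: mult.assoc[symmetric] mult_single add_0)
    finally have c': "(\<Sum>j<n. Poly_Mapping.single 0 (c j) * (l ^ Suc k * v j))
        + Poly_Mapping.single 0 d * (l ^ k * (m * a)) \<in> J" using c by simp
    \<comment> \<open>Otherwise division by \<open>d\<close> would solve for
      \<open>l ^ k * (m * a)\<close> as \<open>l ^ Suc k * b\<close> modulo \<open>J\<close>, which
      \<open>contra\<close> excludes.\<close>
    have d: "d = 0"
    proof (rule ccontr)
      assume d: "d \<noteq> 0"
      define b where "b = - (\<Sum>j<n. Poly_Mapping.single 0 (c j / d) * v j)"
      have "b \<in> poly4_component (int e)"
        unfolding b_def by (intro component_uminus component_sum component_scale v) simp
      moreover have "Poly_Mapping.single 0 (1 / d) * ((\<Sum>j<n. Poly_Mapping.single 0 (c j) * (l ^ Suc k * v j))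
        + Poly_Mapping.single 0 d * (l ^ k * (m * a))) = l ^ k * (m * a) - l ^ Suc k * b"
      proof -
        have f1: "Poly_Mapping.single 0 (1 / d) * (Poly_Mapping.single 0 (c j) * (l ^ Suc k * v j))
            = l ^ Suc k * (Poly_Mapping.single 0 (c j / d) * v j)" for j
        proof -
          have "Poly_Mapping.single 0 (c j / d) = (Poly_Mapping.single 0 (1 / d) * Poly_Mapping.single 0 (c j) :: 'k poly4)"
            by (simp add: mult_single)
          then show ?thesis by (simp only: ac_simps)
        qed
        have f2: "Poly_Mapping.single 0 (1 / d) * (Poly_Mapping.single 0 d * (l ^ k * (m * a))) = l ^ k * (m * a)"
          using d by (simp add: mult.assoc[symmetric] mult_single single_one)
        show ?thesis
          unfolding b_def distrib_left mult_minus_right sum_distrib_left f1 f2 diff_minus_eq_add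
          by (rule add.commute)
      qed
      ultimately show False using contra ideal_set_mult[OF J c', of "Poly_Mapping.single 0 (1 / d)"] by auto
    qed
    \<comment> \<open>Here characteristic zero enters: \<open>k + 1\<close> is a nonzero
      scalar.\<close>
    have cn: "c n = 0" using d by (simp add: d_def del: of_nat_Suc)
    have "(\<Sum>j<n. Poly_Mapping.single 0 (c j) * (l ^ Suc k * v j)) \<in> J" using c' by (simp add: d)
    then have "c i = 0" if "i < n" using indep_modD[OF v(2)] that by simp
    then show "c i = 0" using cn i by (cases "i = n") auto
  qed
  have "\<exists>q\<in>range poly. q 0 \<noteq> 0 \<and> (\<forall>s. q s \<noteq> 0 \<longrightarrow> indep_mod J (Suc n) (w s))"
  proof (rule indep_mod_open[where w = w, OF function_algebra_poly J indep0])
    fix \<phi> :: "'k poly4 \<Rightarrow> 'k" and j assume \<phi>: "klinear \<phi>"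
    \<comment> \<open>The pencil as a combination of two forms indexed by \<open>bool\<close>, the
      shape required by \<open>function_algebra_power_family\<close>.\<close>
    have x: "x s = (\<Sum>i\<in>UNIV. Poly_Mapping.single 0 (if i then s else 1) * (if i then m else l))" for s
      by (simp add: x_def UNIV_bool single_one)
    have c: "(\<lambda>s. if i then s else 1) \<in> range (poly :: 'k poly \<Rightarrow> _)" for i
    proof -
      have "(\<lambda>s::'k. s) = poly [:0, 1:]" "(\<lambda>s::'k. 1) = poly [:1:]" by (simp_all add: fun_eq_iff)
      then show ?thesis by (cases i) auto
    qed
    have pow: "(\<lambda>s. \<phi> (x s ^ i * f)) \<in> range poly" for i f
      unfolding x by (rule function_algebra_power_family[OF function_algebra_poly _ \<phi>]) (rule c)
    have "(\<lambda>s. \<phi> (g s)) \<in> range poly"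
      unfolding g_def klinear_sum[OF \<phi>] by (rule function_algebra_sum[OF function_algebra_poly]) (rule pow)
    then show "(\<lambda>s. \<phi> (w s j)) \<in> range poly"
      by (cases "j < n") (simp_all add: w_def pow del: power_Suc)
  qed
  then obtain q where q: "poly q 0 \<noteq> 0" "\<And>s. poly q s \<noteq> 0 \<Longrightarrow> indep_mod J (Suc n) (w s)" by blast
  \<comment> \<open>The second polynomial keeps \<open>s\<close> away from 0, since modulo
    \<open>J\<close> the element \<open>x s ^ Suc k * a\<close> is \<open>s\<close> times
    \<open>g s\<close>.\<close>
  have "\<exists>s. \<forall>p\<in>{q, [:0, 1:]}. poly p s \<noteq> 0" by (rule poly_common_nonroot) (use q in auto)
  then obtain s where s: "poly q s \<noteq> 0" "s \<noteq> 0" by auto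
  define v' where "v' j = (if j < n then v j else a)" for j
  have "indep_mod J (Suc n) (\<lambda>j. x s ^ Suc k * v' j)"
    unfolding indep_mod_def
  proof (intro allI impI)
    fix c i assume c: "(\<Sum>j<Suc n. Poly_Mapping.single 0 (c j) * (x s ^ Suc k * v' j)) \<in> J" and i: "i < Suc n"
    define c' where "c' j = (if j < n then c j else c j * s)" for j
    have "(\<Sum>j<Suc n. Poly_Mapping.single 0 (c j) * (x s ^ Suc k * v' j))
        = (\<Sum>j<n. Poly_Mapping.single 0 (c j) * (x s ^ Suc k * v j)) + Poly_Mapping.single 0 (c n) * (x s ^ Suc k * a)"
      by (simp add: v'_def del: power_Suc)
    also have "Poly_Mapping.single 0 (c n) * (x s ^ Suc k * a)
        = Poly_Mapping.single 0 (c n * s) * g s + Poly_Mapping.single 0 (c n) * (l ^ Suc k * a)"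
      unfolding xg by (simp only: distrib_left mult.assoc[symmetric] mult_single add_0)
    also have "(\<Sum>j<n. Poly_Mapping.single 0 (c j) * (x s ^ Suc k * v j)) + \<dots>
        = (\<Sum>j<Suc n. Poly_Mapping.single 0 (c' j) * w s j) + Poly_Mapping.single 0 (c n) * (l ^ Suc k * a)"
      by (simp add: c'_def w_def add.assoc del: power_Suc)
    finally have "(\<Sum>j<Suc n. Poly_Mapping.single 0 (c' j) * w s j)
        = (\<Sum>j<Suc n. Poly_Mapping.single 0 (c j) * (x s ^ Suc k * v' j)) - Poly_Mapping.single 0 (c n) * (l ^ Suc k * a)"
      by (simp only: add_diff_cancel_right')
    also have "\<dots> \<in> J" by (intro ideal_set_diff[OF J] c ideal_set_mult[OF J] a(2))
    finally have "c' i = 0" using indep_modD[OF q(2)[OF s(1)] _ i] by blast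
    then show "c i = 0" using s(2) by (auto simp: c'_def split: if_splits)
  qed
  moreover have "v' j \<in> poly4_component (int e)" for j using v(1) a(1) by (simp add: v'_def)
  ultimately have "rank_ge J (x s) e (Suc k) (Suc n)" unfolding rank_ge_def by blast
  moreover have "x s \<in> poly4_component 1" unfolding x_def by (intro component_add component_scale l m)
  ultimately have "rank_ge J l e (Suc k) (Suc n)" using gen unfolding rank_generic_def by blast
  then have "Suc n \<le> n" unfolding n_def by (rule Greatest_le_nat) (use bound in blast)
  then show False by simp
qed

text \<open>Makes injectivity in one degree a rank condition, hence open in \<open>l\<close> and
  inherited by forms of generic rank. A kernel element outside \<open>J\<close> could be added to
  \<open>n\<close> elements with independent images, giving \<open>n + 1\<close> independent
  classes.\<close>

lemma injective_iff_rank: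
  fixes J :: "'k::field poly4 set"
  assumes J: "ideal_set J"
  shows "\<exists>n. \<forall>l. (\<forall>a\<in>poly4_component (int e). l * a \<in> J \<longrightarrow> a \<in> J) \<longleftrightarrow> rank_ge J l e 1 n"
proof -
  \<comment> \<open>The zeroth power makes this the dimension of the image of degree
    \<open>e\<close> in R/J.\<close>
  define n where "n = Greatest (rank_ge J 1 e 0)"
  have bound: "\<forall>n. rank_ge J 1 e 0 n \<longrightarrow> n \<le> card {m :: 4 \<Rightarrow>\<^sub>0 nat. monom_deg m \<le> e}"
    using rank_ge_bound[OF J] by blast
  have "rank_ge J 1 e 0 0" by (simp add: rank_ge_def indep_mod_def)
  then have "rank_ge J 1 e 0 n" unfolding n_def by (rule GreatestI_nat) (use bound in blast)
  then obtain v where v: "\<And>j. j < n \<Longrightarrow> v j \<in> poly4_component (int e)" "indep_mod J n v"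
    unfolding rank_ge_def by auto
  have "rank_ge J l e 1 n" if inj: "\<forall>a\<in>poly4_component (int e). l * a \<in> J \<longrightarrow> a \<in> J" for l
  proof -
    have "indep_mod J n (\<lambda>j. l ^ 1 * v j)"
      unfolding indep_mod_def
    proof (intro allI impI)
      fix c i assume c: "(\<Sum>j<n. Poly_Mapping.single 0 (c j) * (l ^ 1 * v j)) \<in> J" and i: "i < n"
      have "l * (\<Sum>j<n. Poly_Mapping.single 0 (c j) * v j) \<in> J"
        using c by (simp add: sum_distrib_left mult.left_commute)
      moreover have "(\<Sum>j<n. Poly_Mapping.single 0 (c j) * v j) \<in> poly4_component (int e)"
        by (intro component_sum component_scale v) simp
      ultimately have "(\<Sum>j<n. Poly_Mapping.single 0 (c j) * v j) \<in> J" using inj by blast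
      then show "c i = 0" by (rule indep_modD[OF v(2) _ i])
    qed
    then show ?thesis using v(1) unfolding rank_ge_def by blast
  qed
  moreover have "a \<in> J" if l: "rank_ge J l e 1 n" and a: "a \<in> poly4_component (int e)" "l * a \<in> J" for l a
  proof (rule ccontr)
    assume "a \<notin> J"
    obtain u where u: "\<And>j. j < n \<Longrightarrow> u j \<in> poly4_component (int e)" "indep_mod J n (\<lambda>j. l * u j)"
      using l unfolding rank_ge_def by auto
    define u' where "u' j = (if j < n then u j else a)" for j
    have "indep_mod J (Suc n) u'"
      unfolding indep_mod_def
    proof (intro allI impI)
      fix c i assume c: "(\<Sum>j<Suc n. Poly_Mapping.single 0 (c j) * u' j) \<in> J" and i: "i < Suc n"
      have eq: "(\<Sum>j<Suc n. Poly_Mapping.single 0 (c j) * u' j)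
          = (\<Sum>j<n. Poly_Mapping.single 0 (c j) * u j) + Poly_Mapping.single 0 (c n) * a"
        by (simp add: u'_def)
      have "(\<Sum>j<n. Poly_Mapping.single 0 (c j) * (l * u j))
          = l * (\<Sum>j<Suc n. Poly_Mapping.single 0 (c j) * u' j) - Poly_Mapping.single 0 (c n) * (l * a)"
        unfolding eq by (simp add: distrib_left sum_distrib_left mult.left_commute)
      also have "\<dots> \<in> J" by (intro ideal_set_diff[OF J] ideal_set_mult[OF J] c a(2))
      finally have 0: "c j = 0" if "j < n" for j by (rule indep_modD[OF u(2) _ that])
      have "c n = 0"
      proof (rule ccontr)
        assume cn: "c n \<noteq> 0"
        have "Poly_Mapping.single 0 (c n) * a \<in> J" using c unfolding eq by (simp add: 0)
        then have "Poly_Mapping.single 0 (1 / c n) * (Poly_Mapping.single 0 (c n) * a) \<in> J"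
          by (rule ideal_set_mult[OF J])
        then have "a \<in> J" using cn by (simp add: mult.assoc[symmetric] mult_single single_one)
        then show False using \<open>a \<notin> J\<close> by simp
      qed
      then show "c i = 0" using 0[of i] i by (cases "i = n") auto
    qed
    moreover have "u' j \<in> poly4_component (int e)" if "j < Suc n" for j
      using u(1) a(1) by (simp add: u'_def)
    ultimately have "rank_ge J 1 e 0 (Suc n)" unfolding rank_ge_def by auto
    then have "Suc n \<le> n" unfolding n_def by (rule Greatest_le_nat) (use bound in blast)
    then show False by simp
  qed
  ultimately show ?thesis by blast
qed

section \<open>Pencils of linear forms\<close>

text \<open>For \<open>B = {l}\<close> this is injectivity of multiplication by \<open>l\<close> in
  degrees up to \<open>N\<close>; for the set of all variables it says that R/J has no socle
  there.\<close>

definition faithful_upto :: "'k::comm_ring_1 poly4 set \<Rightarrow> 'k poly4 set \<Rightarrow> nat \<Rightarrow> bool" where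
  "faithful_upto J B N \<longleftrightarrow>
     (\<forall>e\<le>N. \<forall>u\<in>poly4_component (int e). (\<forall>l\<in>B. l * u \<in> J) \<longrightarrow> u \<in> J)"

text \<open>Elements killed by \<open>l + s l'\<close> for distinct \<open>s\<close> behave like eigenvectors for distinct eigenvalues.\<close>

lemma pencil_independent:
  fixes J :: "'k::field poly4 set"
  assumes J: "ideal_set J" and l': "l' \<in> poly4_component 1"
    and faithful: "faithful_upto J (insert l (insert l' B)) N"
    and "finite A" and "e + card A \<le> N"
    and "\<And>s. s \<in> A \<Longrightarrow> a s \<in> poly4_component (int e) \<and> a s \<notin> J \<and> (\<forall>b\<in>B. b * a s \<in> J)
           \<and> (l + Poly_Mapping.single 0 s * l') * a s \<in> J"
    and "(\<Sum>s\<in>A. Poly_Mapping.single 0 (c s) * a s) \<in> J"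
  shows "\<forall>s\<in>A. c s = 0"
  using assms(4-)
proof (induction A arbitrary: a c e)
  case (insert t A)
  have a: "a s \<in> poly4_component (int e)" "a s \<notin> J" "\<And>b. b \<in> B \<Longrightarrow> b * a s \<in> J"
      "(l + Poly_Mapping.single 0 s * l') * a s \<in> J" if "s \<in> insert t A" for s
    using insert.prems(2)[OF that] by blast+
  \<comment> \<open>Modulo \<open>J\<close>, the form \<open>l + t l'\<close> annihilates
    \<open>a t\<close> and multiplies \<open>a s\<close> by \<open>(t - s) l'\<close>. One term
    disappears and the degree rises by one, which is why \<open>e + card A \<le> N\<close> is
    preserved.\<close>
  define a' where "a' s = l' * a s" for s
  define c' where "c' s = c s * (t - s)" for s
  have "\<forall>s\<in>A. c' s = 0"
  proof (rule insert.IH)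
    show "Suc e + card A \<le> N" using insert.prems(1) insert.hyps by simp
  next
    fix s assume s: "s \<in> A"
    then have as: "a s \<in> poly4_component (int e)" "a s \<notin> J" "\<And>b. b \<in> B \<Longrightarrow> b * a s \<in> J"
      "(l + Poly_Mapping.single 0 s * l') * a s \<in> J" using a[of s] by auto
    \<comment> \<open>If \<open>l'\<close> killed \<open>a s\<close>, so would \<open>l\<close>, and
      with \<open>B\<close> this contradicts faithfulness.\<close>
    have "a' s \<notin> J"
    proof
      assume *: "a' s \<in> J"
      have "l * a s = (l + Poly_Mapping.single 0 s * l') * a s - Poly_Mapping.single 0 s * a' s"
        by (simp add: a'_def algebra_simps)
      also have "\<dots> \<in> J" by (intro ideal_set_diff[OF J] ideal_set_mult[OF J] * as(4))
      finally have "l * a s \<in> J" .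
      moreover have "e \<le> N" using insert.prems(1) by simp
      ultimately have "a s \<in> J" using faithful as(1,3) * unfolding faithful_upto_def a'_def by auto
      then show False using as(2) by simp
    qed
    moreover have "a' s \<in> poly4_component (int (Suc e))"
      using component_mult[OF l' as(1)] by (simp add: a'_def)
    moreover have "b * a' s \<in> J" if "b \<in> B" for b
      using ideal_set_mult[OF J as(3)[OF that], of l'] by (simp add: a'_def mult.left_commute)
    moreover have "(l + Poly_Mapping.single 0 s * l') * a' s \<in> J"
      using ideal_set_mult[OF J as(4), of l'] by (simp add: a'_def mult.left_commute)
    ultimately show "a' s \<in> poly4_component (int (Suc e)) \<and> a' s \<notin> J \<and> (\<forall>b\<in>B. b * a' s \<in> J)
           \<and> (l + Poly_Mapping.single 0 s * l') * a' s \<in> J" by blast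
  next
    let ?x = "l + Poly_Mapping.single 0 t * l'"
    have summand: "Poly_Mapping.single 0 (c' s) * a' s
        = ?x * (Poly_Mapping.single 0 (c s) * a s) - Poly_Mapping.single 0 (c s) * ((l + Poly_Mapping.single 0 s * l') * a s)" for s
      by (simp add: c'_def a'_def right_diff_distrib single_diff mult_single[of 0 _ 0, simplified, symmetric])
        (simp add: algebra_simps)
    have "?x * (\<Sum>s\<in>insert t A. Poly_Mapping.single 0 (c s) * a s)
          - (\<Sum>s\<in>insert t A. Poly_Mapping.single 0 (c s) * ((l + Poly_Mapping.single 0 s * l') * a s)) \<in> J"
      by (intro ideal_set_diff[OF J] ideal_set_mult[OF J] ideal_set_sum[OF J] insert.prems(3) a(4))
    also have "?x * (\<Sum>s\<in>insert t A. Poly_Mapping.single 0 (c s) * a s)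
          - (\<Sum>s\<in>insert t A. Poly_Mapping.single 0 (c s) * ((l + Poly_Mapping.single 0 s * l') * a s))
        = (\<Sum>s\<in>insert t A. Poly_Mapping.single 0 (c' s) * a' s)"
      unfolding summand sum_subtractf sum_distrib_left ..
    also have "\<dots> = (\<Sum>s\<in>A. Poly_Mapping.single 0 (c' s) * a' s)"
      using insert.hyps by (simp add: c'_def)
    finally show "(\<Sum>s\<in>A. Poly_Mapping.single 0 (c' s) * a' s) \<in> J" .
  qed
  then have A: "c s = 0" if "s \<in> A" for s using that insert.hyps(2) by (auto simp: c'_def)
  have "Poly_Mapping.single 0 (c t) * a t \<in> J" using insert.prems(3) insert.hyps A by simp
  then have *: "Poly_Mapping.single 0 (1 / c t) * (Poly_Mapping.single 0 (c t) * a t) \<in> J"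
    by (rule ideal_set_mult[OF J])
  have "c t = 0"
  proof (rule ccontr)
    assume "c t \<noteq> 0"
    then have "a t \<in> J" using * by (simp add: mult.assoc[symmetric] mult_single single_one)
    then show False using a(2)[of t] by simp
  qed
  then show ?case using A by blast
qed simp

text \<open>If every member of the pencil failed, infinitely many parameters would fail in one
  degree \<open>e \<le> N\<close>. Choosing \<open>Suc (M N)\<close> of them gives too many
  independent elements of that degree; the independence argument climbs one degree per element,
  hence the surplus \<open>Suc (M N)\<close> in the hypothesis.\<close>

lemma pencil_faithful:
  fixes J :: "'k::field_char_0 poly4 set"
  defines "M \<equiv> \<lambda>e. card {m :: 4 \<Rightarrow>\<^sub>0 nat. monom_deg m \<le> e}"
  assumes J: "ideal_set J" and l': "l' \<in> poly4_component 1"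
    and faithful: "faithful_upto J (insert l (insert l' B)) (N + Suc (M N))"
  shows "\<exists>s. faithful_upto J (insert (l + Poly_Mapping.single 0 s * l') B) N"
proof (rule ccontr)
  assume contra: "\<not> ?thesis"
  define K where "K e s u \<longleftrightarrow> u \<in> poly4_component (int e) \<and> u \<notin> J \<and> (\<forall>b\<in>B. b * u \<in> J) \<and>
      (l + Poly_Mapping.single 0 s * l') * u \<in> J" for e s u
  have "\<exists>e\<le>N. \<exists>u. K e s u" for s
  proof -
    have "\<not> faithful_upto J (insert (l + Poly_Mapping.single 0 s * l') B) N" using contra by simp
    then obtain e u where "e \<le> N" "u \<in> poly4_component (int e)" "u \<notin> J"
        "\<forall>b\<in>insert (l + Poly_Mapping.single 0 s * l') B. b * u \<in> J"
      unfolding faithful_upto_def by blast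
    then show ?thesis by (intro exI[of _ e] exI[of _ u] conjI) (simp_all add: K_def)
  qed
  then have "UNIV = (\<Union>e\<in>{..N}. {s. \<exists>u. K e s u})" by blast
  then have "infinite (\<Union>e\<in>{..N}. {s. \<exists>u. K e s u})" using infinite_UNIV_char_0 by metis
  then obtain e where e: "e \<le> N" "infinite {s. \<exists>u. K e s u}" by auto
  then obtain A where A: "finite A" "card A = Suc (M N)" "A \<subseteq> {s. \<exists>u. K e s u}"
    using infinite_arbitrarily_large by blast
  from A(3) have "\<forall>s\<in>A. \<exists>u. K e s u" by blast
  from bchoice[OF this] obtain a where a: "\<forall>s\<in>A. K e s (a s)" ..
  from ex_bij_betw_nat_finite[OF A(1)] obtain h where h: "bij_betw h {..<card A} A"
    by (auto simp: atLeast0LessThan)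
  have "indep_mod J (card A) (\<lambda>j. a (h j))"
    unfolding indep_mod_def
  proof (intro allI impI)
    fix c i assume c: "(\<Sum>j<card A. Poly_Mapping.single 0 (c j) * a (h j)) \<in> J" and i: "i < card A"
    define c' where "c' s = c (inv_into {..<card A} h s)" for s
    have c'h: "c' (h j) = c j" if "j < card A" for j
      using bij_betw_inv_into_left[OF h] that by (simp add: c'_def)
    have "(\<Sum>s\<in>A. Poly_Mapping.single 0 (c' s) * a s) = (\<Sum>j<card A. Poly_Mapping.single 0 (c' (h j)) * a (h j))"
      by (rule sum.reindex_bij_betw[OF h, symmetric])
    also have "\<dots> = (\<Sum>j<card A. Poly_Mapping.single 0 (c j) * a (h j))" by (simp add: c'h)
    finally have c': "(\<Sum>s\<in>A. Poly_Mapping.single 0 (c' s) * a s) \<in> J" using c by simp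
    have "\<forall>s\<in>A. c' s = 0"
      by (rule pencil_independent[OF J l' faithful A(1) _ _ c', where e = e])
        (use a A(2) e(1) in \<open>auto simp: K_def\<close>)
    moreover have "h i \<in> A" using bij_betwE[OF h] i by simp
    ultimately show "c i = 0" using c'h[OF i] by simp
  qed
  moreover have "a (h j) \<in> poly4_component (int e)" if "j < card A" for j
    using a h that unfolding bij_betw_def K_def by auto
  ultimately have "card A \<le> M e" unfolding M_def by (rule indep_mod_bound[OF ideal_set_zero[OF J]])
  also have "\<dots> \<le> M N" unfolding M_def by (rule card_mono[OF finite_monom_deg]) (use e(1) in auto)
  finally show False using A(2) by simp
qed

section \<open>Injectivity of multiplication by a generic linear form\<close>

definition span_ideal :: "nat set \<Rightarrow> (nat \<Rightarrow> 'a::comm_ring_1) \<Rightarrow> 'a set" where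
  "span_ideal A F = range (\<lambda>G. \<Sum>j\<in>A. G j * F j)"

lemma span_idealI: "x = (\<Sum>j\<in>A. G j * F j) \<Longrightarrow> x \<in> span_ideal A F"
  unfolding span_ideal_def by blast

lemma span_idealE:
  assumes "x \<in> span_ideal A F"
  obtains G where "x = (\<Sum>j\<in>A. G j * F j)"
  using assms unfolding span_ideal_def by blast

lemma ideal_set_span_ideal: "ideal_set (span_ideal A F)"
  unfolding ideal_set_def
proof (intro conjI ballI allI)
  show "0 \<in> span_ideal A F" by (rule span_idealI[where G = "\<lambda>_. 0"]) simp
next
  fix f g assume "f \<in> span_ideal A F" "g \<in> span_ideal A F"
  then obtain H K where "f = (\<Sum>j\<in>A. H j * F j)" "g = (\<Sum>j\<in>A. K j * F j)" by (metis span_idealE)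
  then show "f + g \<in> span_ideal A F"
    by (intro span_idealI[where G = "\<lambda>j. H j + K j"]) (simp add: distrib_right sum.distrib)
next
  fix f g assume "f \<in> span_ideal A F"
  then obtain H where "f = (\<Sum>j\<in>A. H j * F j)" by (rule span_idealE)
  then show "g * f \<in> span_ideal A F"
    by (intro span_idealI[where G = "\<lambda>j. g * H j"]) (simp add: sum_distrib_left mult.assoc)
qed

lemma span_ideal_generator: "finite A \<Longrightarrow> i \<in> A \<Longrightarrow> F i \<in> span_ideal A F"
proof (rule span_idealI)
  assume "finite A" "i \<in> A"
  then have "(\<Sum>j\<in>A. (if j = i then 1 else 0) * F j) = (\<Sum>j\<in>{i}. (if j = i then 1 else 0) * F j)"
    by (intro sum.mono_neutral_right) auto
  then show "F i = (\<Sum>j\<in>A. (if j = i then 1 else 0) * F j)" by simp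
qed

lemma hcomp_span_ideal:
  assumes "\<And>j. j \<in> A \<Longrightarrow> F j \<in> poly4_component (d j)" and "x \<in> span_ideal A F"
  shows "hcomp t x \<in> span_ideal A F"
proof -
  obtain G where "x = (\<Sum>j\<in>A. G j * F j)" using assms(2) by (rule span_idealE)
  then have "hcomp t x = (\<Sum>j\<in>A. hcomp (t - d j) (G j) * F j)" using hcomp_sum_mult[OF assms(1)] by simp
  then show ?thesis by (rule span_idealI)
qed

lemma power_cancel:
  assumes l: "l \<in> poly4_component 1"
    and inj: "\<And>e' a. e' < e \<Longrightarrow> a \<in> poly4_component (int e') \<Longrightarrow> l * a \<in> J \<Longrightarrow> a \<in> J"
  shows "a \<in> poly4_component (int e') \<Longrightarrow> e' + j \<le> e \<Longrightarrow> l ^ j * a \<in> J \<Longrightarrow> a \<in> J"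
proof (induction j)
  case (Suc j)
  have "l ^ j * a \<in> poly4_component (int (j + e'))"
    using component_mult[OF component_power[OF l] Suc.prems(1), of j] by simp
  then have "l ^ j * a \<in> J"
    using inj[of "j + e'" "l ^ j * a"] Suc.prems by (simp add: mult.assoc)
  then show ?case using Suc by simp
qed simp

text \<open>
  A form of degree \<open>e\<close> killed by the general \<open>l\<close> produces a socle element of \<open>R/(J, l)\<close>: divide it
  by \<open>l\<close> modulo \<open>J\<close> as often as all forms of degree \<open>e\<close> killed by \<open>l\<close> allow.
\<close>

lemma generic_injective_step:
  fixes F :: "nat \<Rightarrow> 'k::field_char_0 poly4" and d :: "nat \<Rightarrow> int" and n :: nat
  defines "J \<equiv> span_ideal {..<n} F"
  assumes reg: "regular_upto n F" and F: "\<And>j. j < n \<Longrightarrow> F j \<in> poly4_component (d j)"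
    and l: "l \<in> poly4_component 1" "l \<noteq> 0"
    and gen: "\<And>e' k. e' \<le> e \<Longrightarrow> k \<le> Suc e \<Longrightarrow> rank_generic J l e' k"
    and inj: "\<And>e' a. e' < e \<Longrightarrow> a \<in> poly4_component (int e') \<Longrightarrow> l * a \<in> J \<Longrightarrow> a \<in> J"
    and deg: "\<And>i j k. i < n \<Longrightarrow> j < n \<Longrightarrow> k < n \<Longrightarrow> i \<noteq> j \<Longrightarrow> i \<noteq> k \<Longrightarrow> j \<noteq> k \<Longrightarrow>
      2 * (int e + 2) < d i + d j + d k"
    and a0: "a0 \<in> poly4_component (int e)" "l * a0 \<in> J"
  shows "a0 \<in> J"
proof (rule ccontr)
  assume a0J: "a0 \<notin> J"
  have J: "ideal_set J" unfolding J_def by (rule ideal_set_span_ideal)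
  define K where "K = {a \<in> poly4_component (int e). l * a \<in> J}"
  \<comment> \<open>Every form of \<open>K\<close> is divisible by \<open>l ^ i\<close> modulo
    \<open>J\<close>. This holds for \<open>i = 0\<close> and fails for \<open>i > e\<close>, where
    the quotient would have negative degree although \<open>a0\<close> is not in \<open>J\<close>;
    so there is an \<open>i\<close> at which divisibility stops.\<close>
  define Q where "Q i \<longleftrightarrow> (\<forall>a\<in>K. \<exists>b\<in>poly4_component (int e - int i). a - l ^ i * b \<in> J)" for i
  have a0K: "a0 \<in> K" using a0 by (simp add: K_def)
  have notQ: "\<not> Q i" if "i > e" for i
  proof
    assume "Q i"
    then obtain b where b: "b \<in> poly4_component (int e - int i)" "a0 - l ^ i * b \<in> J"
      using a0K unfolding Q_def by blast
    then have "b = 0" using component_neg[OF b(1)] that by simp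
    then show False using b(2) a0J by simp
  qed
  have "Q 0"
    unfolding Q_def
  proof
    fix a assume "a \<in> K"
    then show "\<exists>b\<in>poly4_component (int e - int 0). a - l ^ 0 * b \<in> J"
      using ideal_set_zero[OF J] by (intro bexI[of _ a]) (simp_all add: K_def)
  qed
  then obtain i where i: "Q i" "\<not> Q (Suc i)" using notQ[of "Suc e"] by (metis nat_induct lessI)
  have ie: "i \<le> e" using notQ i(1) by (meson not_le)
  define e' where "e' = e - i"
  have e': "int e - int i = int e'" "e' + i = e" using ie by (simp_all add: e'_def)
  from i(2) obtain a where aK: "a \<in> K"
    and a: "\<And>b. b \<in> poly4_component (int e - int (Suc i)) \<Longrightarrow> a - l ^ Suc i * b \<notin> J"
    unfolding Q_def by blast
  \<comment> \<open>Since \<open>a\<close> cannot be divided once more, its quotient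
    \<open>u\<close> is the socle element that should lie outside \<open>(J, l)\<close>.\<close>
  from i(1) aK obtain u where u: "u \<in> poly4_component (int e')" "a - l ^ i * u \<in> J"
    unfolding Q_def e'(1) by blast
  have "l ^ Suc i * u = l * a - l * (a - l ^ i * u)" by (simp add: algebra_simps)
  also have "\<dots> \<in> J"
    by (rule ideal_set_diff[OF J _ ideal_set_mult[OF J u(2)]]) (use aK in \<open>simp add: K_def\<close>)
  finally have lu: "l ^ Suc i * u \<in> J" .
  have soc: "\<exists>b. m * u - l * b \<in> J" if m: "m \<in> poly4_component 1" for m
  proof -
    have "rank_generic J l e' (Suc i)" using gen e'(2) ie by simp
    from rank_generic_deform[OF J l(1) this m u(1) lu]
    obtain v where v: "v \<in> poly4_component (int e')" "l ^ i * (m * u) - l ^ Suc i * v \<in> J" by blast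
    define z where "z = m * u - l * v"
    have z: "z \<in> poly4_component (int (Suc e'))"
      using component_mult[OF m u(1)] component_mult[OF l(1) v(1)]
      unfolding z_def by (intro component_diff) simp_all
    have lz: "l ^ i * z \<in> J" using v(2) by (simp add: z_def algebra_simps)
    show ?thesis
    proof (cases i)
      case 0
      then show ?thesis using lz by (auto simp: z_def)
    next
      \<comment> \<open>Deformation gives \<open>m * u = l * v\<close> only up to an error
        \<open>z\<close> killed by \<open>l ^ i\<close>. But \<open>l ^ i' * z\<close> has degree
        \<open>e\<close> and lies in \<open>K\<close>, so it is divisible by \<open>l ^ i\<close>;
        cancelling \<open>l ^ i'\<close>, by injectivity below degree \<open>e\<close>, shows that
        \<open>z\<close> is a multiple of \<open>l\<close> modulo \<open>J\<close>.\<close>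
      case (Suc i')
      have "l ^ i' * z \<in> poly4_component (int e)"
        using component_mult[OF component_power[OF l(1)] z, of i'] Suc e'(2)[symmetric] by (simp add: ac_simps)
      then have "l ^ i' * z \<in> K" using lz Suc by (simp add: K_def mult.assoc)
      then obtain v' where v': "v' \<in> poly4_component (int e')" "l ^ i' * z - l ^ i * v' \<in> J"
        using i(1) unfolding Q_def e'(1) by blast
      have "z - l * v' \<in> J"
      proof (rule power_cancel[OF l(1) inj])
        show "z - l * v' \<in> poly4_component (int (Suc e'))"
          using component_mult[OF l(1) v'(1)] by (intro component_diff z) simp
        show "Suc e' + i' \<le> e" using Suc e'(2) by simp
        show "l ^ i' * (z - l * v') \<in> J" using v'(2) Suc by (simp add: algebra_simps)
      qed
      then have "m * u - l * (v + v') \<in> J" by (simp add: z_def algebra_simps)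
      then show ?thesis by blast
    qed
  qed
  have "\<exists>b G. u = l * b + (\<Sum>j<n. G j * F j)"
  proof (rule socle_mod_linear_form[OF reg F l u(1)])
    fix m :: "'k poly4" assume "m \<in> poly4_component 1"
    then obtain b where "m * u - l * b \<in> J" using soc by blast
    then obtain G where "m * u - l * b = (\<Sum>j<n. G j * F j)" unfolding J_def by (rule span_idealE)
    then have "m * u = l * b + (\<Sum>j<n. G j * F j)" by (simp add: algebra_simps)
    then show "\<exists>b G. m * u = l * b + (\<Sum>j<n. G j * F j)" by (intro exI)
  next
    fix i j k assume "i < n" "j < n" "k < n" "i \<noteq> j" "i \<noteq> k" "j \<noteq> k"
    then show "2 * (int e' + 2) < d i + d j + d k" using deg[of i j k] e'(2) by simp
  qed
  \<comment> \<open>Membership of \<open>u\<close> in \<open>(J, l)\<close> makes \<open>a\<close>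
    divisible by \<open>l ^ Suc i\<close>, against its choice. The component of degree
    \<open>e'\<close> is taken to make the new quotient homogeneous.\<close>
  then obtain b G where "u = l * b + (\<Sum>j<n. G j * F j)" by auto
  then have ub: "u - l * b \<in> J" unfolding J_def by (intro span_idealI[where G = G]) simp
  have "hcomp (int e') (u - b * l) \<in> J"
    unfolding J_def by (rule hcomp_span_ideal[where d = d]) (use F ub in \<open>auto simp: J_def mult.commute\<close>)
  moreover have "hcomp (int e') (u - b * l) = u - hcomp (int e' - 1) b * l"
  proof -
    have "hcomp (int e') (u + (- b) * l) = u + hcomp (int e' - 1) (- b) * l"
      unfolding hcomp_add by (simp only: hcomp_id[OF u(1)] hcomp_mult[OF l(1)])
    moreover have "hcomp (int e' - 1) (- b) = - hcomp (int e' - 1) b"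
      by (rule poly_mapping_eqI) (simp add: lookup_hcomp when_def)
    ultimately show ?thesis by simp
  qed
  ultimately have "u - hcomp (int e' - 1) b * l \<in> J" by simp
  then have "(a - l ^ i * u) + l ^ i * (u - hcomp (int e' - 1) b * l) \<in> J"
    by (intro ideal_set_add[OF J u(2)] ideal_set_mult[OF J])
  moreover have "int e - int (Suc i) = int e' - 1" using e'(1) by simp
  ultimately show False using a[of "hcomp (int e' - 1) b"] hcomp_in[of "int e' - 1" b] by (simp add: algebra_simps)
qed

section \<open>The case of one form of large degree\<close>

lemma positive_degree_mult:
  assumes J: "ideal_set J" and u: "\<And>i. pvar i * u \<in> J" and f: "f \<in> poly4_component t" "t > 0"
  shows "f * u \<in> J"
proof -
  have "f * u = (\<Sum>m\<in>Poly_Mapping.keys f. Poly_Mapping.single m (Poly_Mapping.lookup f m) * u)"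
    by (subst poly_mapping_as_sum) (rule sum_distrib_right)
  also have "\<dots> \<in> J"
  proof (rule ideal_set_sum[OF J])
    fix m assume "m \<in> Poly_Mapping.keys f"
    then have "monom_deg m \<noteq> 0" using f by (auto simp: poly4_component_def)
    then obtain i where i: "Poly_Mapping.lookup m i \<noteq> 0" unfolding monom_deg_def by (meson sum.neutral)
    have m: "m = (m - Poly_Mapping.single i 1) + Poly_Mapping.single i 1"
      by (rule poly_mapping_eqI) (use i in \<open>auto simp: lookup_add lookup_minus lookup_single when_def\<close>)
    have "Poly_Mapping.single m (Poly_Mapping.lookup f m)
        = Poly_Mapping.single (m - Poly_Mapping.single i 1) (Poly_Mapping.lookup f m) * pvar i"
      unfolding pvar_def mult_single m[symmetric] by simp
    then have "Poly_Mapping.single m (Poly_Mapping.lookup f m) * u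
        = Poly_Mapping.single (m - Poly_Mapping.single i 1) (Poly_Mapping.lookup f m) * (pvar i * u)"
      by (simp add: mult.assoc)
    then show "Poly_Mapping.single m (Poly_Mapping.lookup f m) * u \<in> J"
      using ideal_set_mult[OF J u] by simp
  qed
  finally show ?thesis .
qed

text \<open>Without socle, the four variables are jointly faithful in every degree.
  \<open>pencil_faithful\<close> merges two linear forms into one member of their pencil; three
  merges leave a single form. Each merge consumes degrees, so the intermediate claims hold for every
  \<open>N\<close>.\<close>

lemma faithful_linear_form_exists:
  fixes J :: "'k::field_char_0 poly4 set"
  assumes J: "ideal_set J" and soc: "\<And>u. (\<And>i. pvar i * u \<in> J) \<Longrightarrow> u \<in> J"
  shows "\<exists>l\<in>poly4_component 1. faithful_upto J {l} N"
proof -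
  have "card (UNIV - {0 :: 4}) = 3" by (simp add: card_Diff_singleton)
  then obtain i1 i2 i3 where "UNIV - {0 :: 4} = {i1, i2, i3}" unfolding card_3_iff by blast
  then have four: "UNIV = {0, i1, i2, i3}" by blast
  have c3: "faithful_upto J (insert (pvar i2) (insert (pvar i3) {pvar 0, pvar i1})) N" for N
    unfolding faithful_upto_def
  proof (intro allI impI ballI)
    fix e u assume u: "\<forall>l\<in>insert (pvar i2) (insert (pvar i3) {pvar 0, pvar i1}). l * u \<in> J"
    have "pvar i * u \<in> J" for i
    proof -
      have "i \<in> {0, i1, i2, i3}" using four by blast
      then show ?thesis using u by auto
    qed
    then show "u \<in> J" by (rule soc)
  qed
  have c2: "\<exists>l\<in>poly4_component 1. faithful_upto J (insert (pvar i1) (insert l {pvar 0})) N" for N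
  proof -
    from pencil_faithful[OF J pvar_component c3, of N] obtain s
      where "faithful_upto J (insert (pvar i2 + Poly_Mapping.single 0 s * pvar i3) {pvar 0, pvar i1}) N" ..
    then show ?thesis
      by (intro bexI[of _ "pvar i2 + Poly_Mapping.single 0 s * pvar i3"] component_add component_scale pvar_component)
        (simp add: insert_commute)
  qed
  have c1: "\<exists>l\<in>poly4_component 1. faithful_upto J (insert (pvar 0) (insert l {})) N" for N
  proof -
    obtain l where l: "l \<in> poly4_component 1"
      "faithful_upto J (insert (pvar i1) (insert l {pvar 0})) (N + Suc (card {m :: 4 \<Rightarrow>\<^sub>0 nat. monom_deg m \<le> N}))"
      using c2 by blast
    from pencil_faithful[OF J l] obtain s
      where "faithful_upto J (insert (pvar i1 + Poly_Mapping.single 0 s * l) {pvar 0}) N" ..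
    then show ?thesis
      by (intro bexI[of _ "pvar i1 + Poly_Mapping.single 0 s * l"] component_add component_scale pvar_component l(1))
        (simp add: insert_commute)
  qed
  obtain l where l: "l \<in> poly4_component 1"
    "faithful_upto J (insert (pvar 0) (insert l {})) (N + Suc (card {m :: 4 \<Rightarrow>\<^sub>0 nat. monom_deg m \<le> N}))"
    using c1 by blast
  from pencil_faithful[OF J l] obtain s
    where "faithful_upto J (insert (pvar 0 + Poly_Mapping.single 0 s * l) {}) N" ..
  then show ?thesis
    by (intro bexI[of _ "pvar 0 + Poly_Mapping.single 0 s * l"] component_add component_scale pvar_component l(1))
qed

text \<open>\<open>J\<close> omits the form of large degree. A socle element \<open>u\<close> of R/J
  is killed by that form, which has positive degree, and regularity of the whole sequence then
  forces \<open>u\<close> into \<open>J\<close>.\<close>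

lemma large_degree_injective:
  fixes F :: "nat \<Rightarrow> 'k::field_char_0 poly4" and d :: "nat \<Rightarrow> int"
  assumes reg: "regular_upto n F" and F: "\<And>j. j < n \<Longrightarrow> F j \<in> poly4_component (d j)"
    and i: "i < n" "int e + 1 < d i"
  shows "\<exists>l\<in>poly4_component 1. \<forall>a\<in>poly4_component (int e). l * a \<in> span_ideal {..<n} F \<longrightarrow> a \<in> span_ideal {..<n} F"
proof -
  define J where "J = span_ideal ({..<n} - {i}) F"
  have J: "ideal_set J" unfolding J_def by (rule ideal_set_span_ideal)
  have split: "(\<Sum>j<n. G j * F j) = G i * F i + (\<Sum>j\<in>{..<n} - {i}. G j * F j)" for G
    using i(1) by (simp add: sum.remove)
  have "\<exists>l\<in>poly4_component 1. faithful_upto J {l} e"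
  proof (rule faithful_linear_form_exists[OF J])
    fix u assume u: "\<And>i. pvar i * u \<in> J"
    have "F i * u \<in> J" by (rule positive_degree_mult[OF J u F[OF i(1)]]) (use i(2) in simp)
    then obtain G where G: "F i * u = (\<Sum>j\<in>{..<n} - {i}. G j * F j)" unfolding J_def by (rule span_idealE)
    \<comment> \<open>A relation with \<open>u\<close> in position \<open>i\<close>. The alternating
      matrix has \<open>W i i = 0\<close>, so \<open>u\<close> is a combination of the other forms,
      wherever \<open>i\<close> stands in the sequence.\<close>
    define H where "H j = (if j = i then u else - G j)" for j
    have H: "(\<Sum>j\<in>{..<n} - {i}. H j * F j) = - (\<Sum>j\<in>{..<n} - {i}. G j * F j)"
      unfolding sum_negf[symmetric] by (rule sum.cong) (auto simp: H_def)
    have "(\<Sum>j<n. H j * F j) = 0"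
      unfolding split H G[symmetric] by (simp add: H_def mult.commute)
    from koszul_exact_1[OF reg this] obtain W where W: "\<And>i. W i i = 0"
      "\<And>i. i < n \<Longrightarrow> H i = (\<Sum>j<n. W i j * F j)" by blast
    have "u = (\<Sum>j\<in>{..<n} - {i}. W i j * F j)"
      using W(2)[OF i(1)] unfolding split by (simp add: H_def W(1))
    then show "u \<in> J" unfolding J_def by (rule span_idealI)
  qed
  then obtain l where l: "l \<in> poly4_component 1" "faithful_upto J {l} e" by blast
  have "a \<in> span_ideal {..<n} F" if a: "a \<in> poly4_component (int e)" "l * a \<in> span_ideal {..<n} F" for a
  proof -
    obtain G where G: "l * a = (\<Sum>j<n. G j * F j)" using a(2) by (rule span_idealE)
    have "l * a \<in> poly4_component (int e + 1)" using component_mult[OF l(1) a(1)] by (simp add: add.commute)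
    then have "l * a = hcomp (int e + 1) (\<Sum>j<n. G j * F j)" using G by (simp add: hcomp_id)
    also have "\<dots> = (\<Sum>j<n. hcomp (int e + 1 - d j) (G j) * F j)" by (rule hcomp_sum_mult) (simp add: F)
    also have "\<dots> = (\<Sum>j\<in>{..<n} - {i}. hcomp (int e + 1 - d j) (G j) * F j)"
    proof -
      \<comment> \<open>In degree \<open>e + 1\<close> the ideal does not yet see
        \<open>F i\<close>, because \<open>d i > e + 1\<close>.\<close>
      have "hcomp (int e + 1 - d i) (G i) = 0" by (rule component_neg[OF hcomp_in]) (use i(2) in simp)
      then show ?thesis unfolding split by simp
    qed
    finally have "l * a \<in> J" unfolding J_def by (rule span_idealI)
    then have "a \<in> J" using l(2) a(1) unfolding faithful_upto_def by auto
    then obtain G where "a = (\<Sum>j\<in>{..<n} - {i}. G j * F j)" unfolding J_def by (rule span_idealE)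
    then have "a = (\<Sum>j<n. (G(i := 0)) j * F j)" unfolding split by simp
    then show ?thesis by (rule span_idealI)
  qed
  then show ?thesis using l(1) by blast
qed

text \<open>Induction on the degree, since \<open>generic_injective_step\<close> needs injectivity
  in all smaller degrees. The case distinction is made anew for each \<open>e\<close>.\<close>

lemma generic_injective:
  fixes F :: "nat \<Rightarrow> 'k::field_char_0 poly4" and d :: "nat \<Rightarrow> int"
  defines "J \<equiv> span_ideal {..<4} F"
  assumes reg: "regular_upto 4 F" and F: "\<And>j. j < 4 \<Longrightarrow> F j \<in> poly4_component (d j)"
    and l: "l \<in> poly4_component 1" "l \<noteq> 0"
    and gen: "\<And>e' k. e' \<le> N \<Longrightarrow> k \<le> Suc N \<Longrightarrow> rank_generic J l e' k"
    and sum: "3 * (int N + 2) \<le> d 0 + d 1 + d 2 + d 3"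
  shows "e \<le> N \<Longrightarrow> a \<in> poly4_component (int e) \<Longrightarrow> l * a \<in> J \<Longrightarrow> a \<in> J"
proof (induction e arbitrary: a rule: less_induct)
  case (less e)
  have J: "ideal_set J" unfolding J_def by (rule ideal_set_span_ideal)
  show ?case
  proof (cases "\<exists>i<4. int e + 1 < d i")
    case True
    then obtain i where "i < 4" "int e + 1 < d i" by blast
    from large_degree_injective[OF reg F this] obtain l' where l': "l' \<in> poly4_component 1"
      "\<forall>a\<in>poly4_component (int e). l' * a \<in> J \<longrightarrow> a \<in> J" unfolding J_def by blast
    from injective_iff_rank[OF J, of e] obtain n
      where n: "\<And>l. (\<forall>a\<in>poly4_component (int e). l * a \<in> J \<longrightarrow> a \<in> J) \<longleftrightarrow> rank_ge J l e 1 n" by blast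
    \<comment> \<open>The good form \<open>l'\<close> attains the rank \<open>n\<close> that
      characterizes injectivity; hence so does \<open>l\<close>, whose rank is maximal.\<close>
    have "rank_ge J l' e 1 n" using n l'(2) by blast
    then have "rank_ge J l e 1 n"
      using gen[of e 1] less.prems(1) l'(1) unfolding rank_generic_def by simp
    then show ?thesis using n less.prems(2,3) by blast
  next
    case False
    then have "d i \<le> int e + 1" if "i < 4" for i using that by force
    then have small: "d 0 \<le> int e + 1" "d 1 \<le> int e + 1" "d 2 \<le> int e + 1" "d 3 \<le> int e + 1"
      by simp_all
    \<comment> \<open>Leaving out one degree, at most \<open>e + 1\<close>, from a sum of at least
      \<open>3 * (e + 2)\<close> keeps at least \<open>2 * e + 5\<close>.\<close>
    have deg: "2 * (int e + 2) < d i + d j + d k"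
      if "i < 4" "j < 4" "k < 4" "i \<noteq> j" "i \<noteq> k" "j \<noteq> k" for i j k
    proof -
      have "i = 0 \<or> i = 1 \<or> i = 2 \<or> i = 3" "j = 0 \<or> j = 1 \<or> j = 2 \<or> j = 3" "k = 0 \<or> k = 1 \<or> k = 2 \<or> k = 3"
        using that by auto
      moreover have "int e \<le> int N" using less.prems(1) by simp
      ultimately show ?thesis using that small sum by (elim disjE) (simp_all only:, auto)
    qed
    show ?thesis
    proof (rule generic_injective_step[OF reg F l, where e = e, folded J_def])
      show "rank_generic J l e' k" if "e' \<le> e" "k \<le> Suc e" for e' k
        using gen that less.prems(1) by simp
      show "b \<in> J" if "e' < e" "b \<in> poly4_component (int e')" "l * b \<in> J" for e' b
        using less.IH[OF that(1)] that less.prems(1) by simp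
    qed (use deg less.prems in auto)
  qed
qed

section \<open>Translation to quotient rings\<close>

lemma coset_eq: "I +>\<^bsub>poly4_ring\<^esub> f = {h + f | h. h \<in> I}"
  by (auto simp: a_r_coset_def r_coset_def ring_of_type_algebra_def)

lemma coset_eq_iff:
  assumes "ideal_set I"
  shows "I +>\<^bsub>poly4_ring\<^esub> f = I +>\<^bsub>poly4_ring\<^esub> g \<longleftrightarrow> f - g \<in> I"
proof
  assume eq: "I +>\<^bsub>poly4_ring\<^esub> f = I +>\<^bsub>poly4_ring\<^esub> g"
  have "0 + f \<in> I +>\<^bsub>poly4_ring\<^esub> f" unfolding coset_eq using ideal_set_zero[OF assms] by blast
  then obtain h where "h \<in> I" "f = h + g" unfolding eq unfolding coset_eq by auto
  then show "f - g \<in> I" by simp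
next
  have sub: "I +>\<^bsub>poly4_ring\<^esub> f \<subseteq> I +>\<^bsub>poly4_ring\<^esub> g" if "f - g \<in> I" for f g
    unfolding coset_eq
  proof clarify
    fix h assume "h \<in> I"
    then have "h + (f - g) \<in> I" using ideal_set_add[OF assms] that by blast
    moreover have "h + f = (h + (f - g)) + g" by simp
    ultimately show "\<exists>h'. h + f = h' + g \<and> h' \<in> I" by blast
  qed
  assume "f - g \<in> I"
  moreover from this have "g - f \<in> I" using ideal_set_uminus[OF assms] by fastforce
  ultimately show "I +>\<^bsub>poly4_ring\<^esub> f = I +>\<^bsub>poly4_ring\<^esub> g" using sub by blast
qed

lemma ideal_poly4_ring_iff:
  fixes I :: "'k::comm_ring_1 poly4 set"
  shows "ideal I poly4_ring \<longleftrightarrow> ideal_set I"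
proof
  assume I: "ideal I poly4_ring"
  interpret ideal I poly4_ring by (rule I)
  have "f + g \<in> I" if "f \<in> I" "g \<in> I" for f g using additive_subgroup.a_closed[OF ideal.axioms(1)[OF I] that]
    by (simp add: ring_of_type_algebra_def)
  moreover have "g * f \<in> I" if "f \<in> I" for f g
    using I_l_closed[OF that, of g] by (simp add: ring_of_type_algebra_def)
  moreover have "0 \<in> I" using additive_subgroup.zero_closed[OF ideal.axioms(1)[OF I]] by (simp add: ring_of_type_algebra_def)
  ultimately show "ideal_set I" by (simp add: ideal_set_def)
next
  assume I: "ideal_set I"
  interpret R: cring "poly4_ring :: 'k poly4 ring" by (rule cring_from_type_algebra)
  show "ideal I poly4_ring"
  proof (rule idealI[OF R.ring_axioms])
    have inv: "inv\<^bsub>add_monoid poly4_ring\<^esub> x = - x" for x :: "'k poly4"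
      by (rule group.inv_equality[OF R.a_group]) (simp_all add: ring_of_type_algebra_def)
    show "subgroup I (add_monoid poly4_ring)"
    proof (rule group.subgroupI[OF R.a_group])
      show "I \<noteq> {}" using ideal_set_zero[OF I] by blast
      show "inv\<^bsub>add_monoid poly4_ring\<^esub> a \<in> I" if "a \<in> I" for a
        unfolding inv using that by (rule ideal_set_uminus[OF I])
    qed (use ideal_set_add[OF I] in \<open>auto simp: ring_of_type_algebra_def\<close>)
  qed (use ideal_set_mult[OF I] in \<open>auto simp: ring_of_type_algebra_def mult.commute\<close>)
qed

lemma genideal_eq_span_ideal:
  fixes F :: "nat \<Rightarrow> 'k::comm_ring_1 poly4"
  shows "Idl\<^bsub>poly4_ring\<^esub> (F ` {..<n}) = span_ideal {..<n} F"
proof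
  interpret R: cring "poly4_ring :: 'k poly4 ring" by (rule cring_from_type_algebra)
  show "Idl\<^bsub>poly4_ring\<^esub> (F ` {..<n}) \<subseteq> span_ideal {..<n} F"
    by (rule R.genideal_minimal)
      (auto simp: ideal_poly4_ring_iff ideal_set_span_ideal intro: span_ideal_generator)
  have sub: "F ` {..<n} \<subseteq> carrier poly4_ring" by (simp add: ring_of_type_algebra_def)
  have "ideal_set (Idl\<^bsub>poly4_ring\<^esub> (F ` {..<n}))"
    using R.genideal_ideal[OF sub] by (simp add: ideal_poly4_ring_iff)
  then show "span_ideal {..<n} F \<subseteq> Idl\<^bsub>poly4_ring\<^esub> (F ` {..<n})"
    using R.genideal_self[OF sub]
    by (auto simp: span_ideal_def intro!: ideal_set_sum ideal_set_mult)
qed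

lemma quot_mult:
  assumes "ideal_set I"
  shows "(I +>\<^bsub>poly4_ring\<^esub> f) \<otimes>\<^bsub>poly4_ring Quot I\<^esub> (I +>\<^bsub>poly4_ring\<^esub> g) = I +>\<^bsub>poly4_ring\<^esub> (f * g)"
proof -
  interpret ideal I poly4_ring using assms by (simp add: ideal_poly4_ring_iff)
  show ?thesis using rcoset_mult_add[of f g] by (simp add: FactRing_def ring_of_type_algebra_def)
qed

lemma nonzerodivisor_modD:
  assumes I: "ideal_set I" and nz: "nonzerodivisor_mod poly4_ring I f" and x: "f * x \<in> I"
  shows "x \<in> I"
proof -
  have zero: "I +>\<^bsub>poly4_ring\<^esub> g = I \<longleftrightarrow> g \<in> I" for g
    using coset_eq_iff[OF I, of g 0] by (simp add: coset_eq)
  have "I +>\<^bsub>poly4_ring\<^esub> x \<in> carrier (poly4_ring Quot I)"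
    by (auto simp: FactRing_def A_RCOSETS_def RCOSETS_def a_r_coset_def ring_of_type_algebra_def)
  moreover have "(I +>\<^bsub>poly4_ring\<^esub> f) \<otimes>\<^bsub>poly4_ring Quot I\<^esub> (I +>\<^bsub>poly4_ring\<^esub> x) = \<zero>\<^bsub>poly4_ring Quot I\<^esub>"
    using x by (simp add: quot_mult[OF I]) (simp add: FactRing_def zero)
  ultimately have "I +>\<^bsub>poly4_ring\<^esub> x = \<zero>\<^bsub>poly4_ring Quot I\<^esub>"
    using nz unfolding nonzerodivisor_mod_def by blast
  then show ?thesis by (simp add: FactRing_def zero)
qed

lemma regular_sequence_imp_regular_upto:
  fixes F :: "nat \<Rightarrow> 'k::comm_ring_1 poly4"
  assumes "regular_sequence poly4_ring (map F [0..<n])"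
  shows "regular_upto n F"
  unfolding regular_upto_def
proof (intro allI impI)
  fix m x c assume m: "m < n" and c: "x * F m = (\<Sum>j<m. c j * F j)"
  have "set (take m (map F [0..<n])) = F ` {..<m}"
    using m by (simp add: take_map atLeast0LessThan)
  then have "nonzerodivisor_mod poly4_ring (span_ideal {..<m} F) (F m)"
    using assms m genideal_eq_span_ideal[of F m] unfolding regular_sequence_def by fastforce
  moreover have "F m * x \<in> span_ideal {..<m} F" by (rule span_idealI[where G = c]) (simp add: c mult.commute)
  ultimately have "x \<in> span_ideal {..<m} F" by (rule nonzerodivisor_modD[OF ideal_set_span_ideal])
  then show "\<exists>c'. x = (\<Sum>j<m. c' j * F j)" by (auto elim: span_idealE)
qed

lemma inj_on_mult_map:
  assumes I: "ideal_set I" and inj: "\<And>a. a \<in> poly4_component t \<Longrightarrow> l * a \<in> I \<Longrightarrow> a \<in> I"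
  shows "inj_on (mult_map I l) (quot_component I t)"
proof (rule inj_onI)
  fix x y assume "x \<in> quot_component I t" "y \<in> quot_component I t" and eq: "mult_map I l x = mult_map I l y"
  then obtain f g where f: "f \<in> poly4_component t" "x = I +>\<^bsub>poly4_ring\<^esub> f"
    and g: "g \<in> poly4_component t" "y = I +>\<^bsub>poly4_ring\<^esub> g"
    unfolding quot_component_def by blast
  have "l * (f - g) \<in> I"
    using eq by (simp add: mult_map_def f(2) g(2) quot_mult[OF I] coset_eq_iff[OF I] right_diff_distrib)
  then have "f - g \<in> I" using inj component_diff[OF f(1) g(1)] by blast
  then show "x = y" by (simp add: f(2) g(2) coset_eq_iff[OF I])
qed

theorem proposition7p5:
  fixes F1 F2 F3 F4 :: "'k::{alg_closed_field, field_char_0} poly4"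
    and d1 d2 d3 d4 :: nat
    and lam r :: int
    and I :: "'k poly4 set"
  assumes "F1 \<in> poly4_component (int d1)"
    and "F2 \<in> poly4_component (int d2)"
    and "F3 \<in> poly4_component (int d3)"
    and "F4 \<in> poly4_component (int d4)"
    and "regular_sequence poly4_ring [F1, F2, F3, F4]"
    and "I = Idl\<^bsub>poly4_ring\<^esub> {F1, F2, F3, F4}"
    and "int d1 + int d2 + int d3 + int d4 = 3 * lam + r"
    and "0 \<le> r" and "r \<le> 2"
  shows "for_general_linear_form
           (\<lambda>L. \<forall>t::int. t < lam \<longrightarrow> inj_on (mult_map I L) (quot_component I (t - 1)))"
proof -
  define F where "F j = [F1, F2, F3, F4] ! j" for j
  define d where "d j = int ([d1, d2, d3, d4] ! j)" for j
  have F: "F j \<in> poly4_component (d j)" if "j < 4" for j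
    using that assms(1-4) by (auto simp: F_def d_def less_Suc_eq numeral_eq_Suc)
  have upt: "[0..<4] = [0, 1, 2, 3 :: nat]" by (simp add: upt_rec)
  have reg: "regular_upto 4 F"
    by (rule regular_sequence_imp_regular_upto) (use assms(5) in \<open>simp add: upt F_def\<close>)
  have "F ` {..<4} = {F1, F2, F3, F4}" by (simp add: F_def lessThan_Suc numeral_eq_Suc insert_commute)
  then have I: "I = span_ideal {..<4} F" using assms(6) genideal_eq_span_ideal[of F 4] by simp
  have idl: "ideal_set I" unfolding I by (rule ideal_set_span_ideal)
  \<comment> \<open>The largest source degree: \<open>t < lam\<close> and \<open>e = t - 1\<close>
    give \<open>e \<le> lam - 2\<close>.\<close>
  define N where "N = nat (lam - 2)"
  obtain c where c: "lin c \<noteq> 0" "\<forall>e\<le>Suc N. \<forall>k\<le>Suc N. rank_generic I (lin c) e k"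
    using generic_form_exists[OF idl, of "Suc N"] by blast
  define inje where "inje l e \<longleftrightarrow> (\<forall>a\<in>poly4_component (int e). l * a \<in> I \<longrightarrow> a \<in> I)" for l e
  have inj: "inje (lin c) e" if "int e + 2 \<le> lam" for e
    unfolding inje_def
  proof (intro ballI impI)
    fix a assume a: "a \<in> poly4_component (int e)" "lin c * a \<in> I"
    show "a \<in> I"
      unfolding I
    proof (rule generic_injective[OF reg F lin_component c(1)])
      show "rank_generic (span_ideal {..<4} F) (lin c) e' k" if "e' \<le> N" "k \<le> Suc N" for e' k
        using c(2) that unfolding I by simp
      \<comment> \<open>Here \<open>lam \<ge> 2\<close>, so the left side is \<open>3 * lam\<close>,
        and \<open>r\<close> is nonnegative.\<close>
      show "3 * (int N + 2) \<le> d 0 + d 1 + d 2 + d 3"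
        using assms(7-9) that by (simp add: d_def N_def numeral_eq_Suc)
      show "e \<le> N" using that by (simp add: N_def)
    qed (use a in \<open>simp_all add: I\<close>)
  qed
  \<comment> \<open>Injectivity at the one form \<open>lin c\<close> spreads to a neighbourhood,
    separately for each degree.\<close>
  have "\<exists>q\<in>range poly4_eval. q c \<noteq> 0 \<and> (\<forall>c'. q c' \<noteq> 0 \<longrightarrow> inje (lin c') e)" if e: "int e + 2 \<le> lam" for e
  proof -
    obtain n where n: "\<And>l. inje l e \<longleftrightarrow> rank_ge I l e 1 n"
      using injective_iff_rank[OF idl, of e] unfolding inje_def by blast
    show ?thesis using rank_ge_open[OF idl] inj[OF e] unfolding n .
  qed
  then have "\<forall>e\<in>{e. int e + 2 \<le> lam}. \<exists>p. poly4_eval p c \<noteq> 0 \<and> (\<forall>c'. poly4_eval p c' \<noteq> 0 \<longrightarrow> inje (lin c') e)"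
    by blast
  from bchoice[OF this] obtain p where p: "\<And>e. int e + 2 \<le> lam \<Longrightarrow> poly4_eval (p e) c \<noteq> 0"
    "\<And>e c'. int e + 2 \<le> lam \<Longrightarrow> poly4_eval (p e) c' \<noteq> 0 \<Longrightarrow> inje (lin c') e" by blast
  define E where "E = {e. int e + 2 \<le> lam}"
  have "finite E" by (rule finite_subset[of _ "{..nat lam}"]) (auto simp: E_def)
  \<comment> \<open>Only finitely many degrees \<open>e\<close> are involved, so the product of
    their polynomials cuts out a single open set, nonempty because it contains
    \<open>lin c\<close>.\<close>
  define P where "P = (\<Prod>e\<in>E. p e)"
  have P: "poly4_eval P x = (\<Prod>e\<in>E. poly4_eval (p e) x)" for x
    unfolding P_def poly4_eval_prod ..
  define V where "V = {l \<in> poly4_component 1. \<exists>f\<in>{P}. poly4_eval f (linear_coeffs l) \<noteq> 0}"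
  have "zariski_open_linear V" unfolding zariski_open_linear_def V_def by blast
  moreover have "lin c \<in> V"
    using p(1) \<open>finite E\<close> by (simp add: V_def lin_component linear_coeffs_lin P E_def)
  moreover have "inj_on (mult_map I l) (quot_component I (t - 1))" if l: "l \<in> V" and t: "t < lam" for l t
  proof (rule inj_on_mult_map[OF idl])
    fix a assume a: "a \<in> poly4_component (t - 1)" "l * a \<in> I"
    show "a \<in> I"
    proof (cases "t \<ge> 1")
      case False
      then have "a = 0" using component_neg[OF a(1)] by simp
      then show ?thesis using ideal_set_zero[OF idl] by simp
    next
      case True
      define e where "e = nat (t - 1)"
      have e: "int e = t - 1" "int e + 2 \<le> lam" using True t by (simp_all add: e_def)
      have "poly4_eval (p e) (linear_coeffs l) \<noteq> 0"
        using l e(2) \<open>finite E\<close> by (simp add: V_def P E_def)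
      then have "inje (lin (linear_coeffs l)) e" by (rule p(2)[OF e(2)])
      moreover have "lin (linear_coeffs l) = l" using l by (simp add: V_def lin_linear_coeffs)
      ultimately show ?thesis using a unfolding inje_def e(1) by simp
    qed
  qed
  ultimately show ?thesis unfolding for_general_linear_form_def by blast
qed

end
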